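(* Assume $\mathfrak{d}=2^{\aleph_0}$. Then for every cardinal $\kappa$ with $\aleph_0\le\kappa<2^{\aleph_0}$ there exists an ultrafilter on the Cohen algebra $\mathbb{C}_\kappa$ which is not Tukey maximal.
   Context: $\mathfrak{d}$ is the dominating number. $\mathcal{M}$ is the ideal of meagre subsets of ${}^\omega 2$. For an infinite ordinal $\alpha$, let $\mathcal{M}(\alpha)$ be the family of all $X\subseteq{}^\alpha 2$ for which there exist an injective $\Delta\colon\omega\to\alpha$ and $Y\in\mathcal{M}$ such that $f\circ\Delta\in Y$ for all $f\in X$ (a $\sigma$-ideal over ${}^\alpha 2$). Let $\mathcal{B}({}^\alpha 2)$ be the $\sigma$-algebra of subsets of ${}^\alpha 2$ generated by the clopen subsets of the Cantor space ${}^\alpha 2$. The Cohen algebra is $\mathbb{C}_\alpha=\mathcal{B}({}^\alpha 2)/\mathcal{M}(\alpha)$. For directed sets $\langle D,\le^D\rangle$, $\langle E,\le^E\rangle$, write $D\le_{\mathrm{T}}E$ if there are functions $f\colon D\to E$ and $g\colon E\to D$ such that for all $d\in D$, $e\in E$: $f(d)\le^E e\implies d\le^D g(e)$. An ultrafilter $U$ on a Boolean algebra $\mathbb{B}$ is regarded as the directed set $\langle U,\ge\rangle$ (reverse Boolean order), and $U$ is Tukey maximal if $\langle[\mathbb{B}]^{<\aleph_0},\subseteq\rangle\le_{\mathrm{T}}\langle U,\ge\rangle$, where $[\mathbb{B}]^{<\aleph_0}$ is the set of finite subsets of $\mathbb{B}$. *)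

theory Defs
  imports "HOL-Analysis.Analysis" "HOL-Algebra.Lattice"
begin

unbundle cardinal_syntax

section \<open>The dominating number\<close>

definition dominating_family :: "(nat \<Rightarrow> nat) set \<Rightarrow> bool" where
  "dominating_family F \<longleftrightarrow> (\<forall>g. \<exists>f\<in>F. \<forall>\<^sub>F n in sequentially. g n \<le> f n)"

definition dominating_number :: "(nat \<Rightarrow> nat) rel" where
  "dominating_number =
     |SOME F. dominating_family F \<and> (\<forall>G. dominating_family G \<longrightarrow> |F| \<le>o |G| )|"

text \<open>The choice above is from a nonempty collection, so this is the least cardinality.\<close>

lemma dominating_number_attained:
  "\<exists>F. dominating_family F \<and> dominating_number = |F|"
  and dominating_number_least:
  "\<And>G. dominating_family G \<Longrightarrow> dominating_number \<le>o |G|"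
proof -
  let ?R = "card_of ` {F. dominating_family F}"
  have "dominating_family UNIV"
    unfolding dominating_family_def by (intro allI, rule_tac x=g in bexI) simp_all
  then have "?R \<noteq> {}" by blast
  moreover have "\<forall>r\<in>?R. Card_order r" by (simp add: card_of_Card_order)
  ultimately have "\<exists>r\<in>?R. \<forall>r'\<in>?R. r \<le>o r'"
    by (rule exists_minim_Card_order)
  then have ex: "\<exists>F. dominating_family F \<and> (\<forall>G. dominating_family G \<longrightarrow> |F| \<le>o |G| )"
    by (simp add: Bex_def)
  show "\<exists>F. dominating_family F \<and> dominating_number = |F|"
    unfolding dominating_number_def using someI_ex[OF ex] by blast
  show "dominating_number \<le>o |G|" if "dominating_family G" for G
    unfolding dominating_number_def using someI_ex[OF ex] that by blast
qed


section \<open>Meagre sets and the Cohen algebra\<close>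

definition nowhere_dense_in :: "'a topology \<Rightarrow> 'a set \<Rightarrow> bool" where
  "nowhere_dense_in T S \<longleftrightarrow> S \<subseteq> topspace T \<and> T interior_of (T closure_of S) = {}"

definition meagre_in :: "'a topology \<Rightarrow> 'a set \<Rightarrow> bool" where
  "meagre_in T S \<longleftrightarrow> (\<exists>\<N>. countable \<N> \<and> (\<forall>N\<in>\<N>. nowhere_dense_in T N) \<and> S = \<Union>\<N>)"

text \<open>
  The points of \<open>cantor_space A\<close> are the functions from \<open>A\<close> to \<^typ>\<open>bool\<close>, represented
  extensionally (\<^const>\<open>undefined\<close> off \<open>A\<close>). All notions below depend on an ordinal only
  through its underlying set, hence are indexed by a set \<open>A\<close>.
\<close>

definition cantor_space :: "'a set \<Rightarrow> ('a \<Rightarrow> bool) topology" where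
  "cantor_space A = product_topology (\<lambda>_. discrete_topology UNIV) A"

definition meagre_ideal :: "'a set \<Rightarrow> ('a \<Rightarrow> bool) set set" where
  "meagre_ideal A =
     {X. X \<subseteq> topspace (cantor_space A) \<and>
         (\<exists>\<Delta> Y. inj \<Delta> \<and> range \<Delta> \<subseteq> A \<and> meagre_in (cantor_space (UNIV :: nat set)) Y \<and>
                (\<forall>f\<in>X. f \<circ> \<Delta> \<in> Y))}"

definition baire_algebra :: "'a set \<Rightarrow> ('a \<Rightarrow> bool) set set" where
  "baire_algebra A =
     sigma_sets (topspace (cantor_space A))
       {C. openin (cantor_space A) C \<and> closedin (cantor_space A) C}"

definition meagre_equiv :: "'a set \<Rightarrow> (('a \<Rightarrow> bool) set \<times> ('a \<Rightarrow> bool) set) set" where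
  "meagre_equiv A =
     {(X, Y). X \<in> baire_algebra A \<and> Y \<in> baire_algebra A \<and> (X - Y) \<union> (Y - X) \<in> meagre_ideal A}"

text \<open>
  A Boolean algebra is given by its carrier and its order, from which the library derives
  the lattice operations and bounds.
\<close>

definition cohen_algebra :: "'a set \<Rightarrow> ('a \<Rightarrow> bool) set set gorder" where
  "cohen_algebra A =
     \<lparr> carrier = baire_algebra A // meagre_equiv A,
       eq = (=),
       le = (\<lambda>a b. \<exists>X\<in>a. \<exists>Y\<in>b. X - Y \<in> meagre_ideal A) \<rparr>"


section \<open>Ultrafilters and Tukey reducibility\<close>

definition proper_filter :: "'a gorder \<Rightarrow> 'a set \<Rightarrow> bool" where
  "proper_filter B F \<longleftrightarrow>
     F \<subseteq> carrier B \<and> \<top>\<^bsub>B\<^esub> \<in> F \<and> \<bottom>\<^bsub>B\<^esub> \<notin> F \<and>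
     (\<forall>x\<in>F. \<forall>y\<in>F. x \<sqinter>\<^bsub>B\<^esub> y \<in> F) \<and>
     (\<forall>x\<in>F. \<forall>y\<in>carrier B. x \<sqsubseteq>\<^bsub>B\<^esub> y \<longrightarrow> y \<in> F)"

definition ultrafilter_on :: "'a gorder \<Rightarrow> 'a set \<Rightarrow> bool" where
  "ultrafilter_on B U \<longleftrightarrow>
     proper_filter B U \<and> (\<forall>F. proper_filter B F \<and> U \<subseteq> F \<longrightarrow> F = U)"

definition tukey_reducible :: "'a gorder \<Rightarrow> 'b gorder \<Rightarrow> bool" (infix \<open>\<le>\<^sub>T\<close> 50) where
  "D \<le>\<^sub>T E \<longleftrightarrow>
     (\<exists>f \<in> carrier D \<rightarrow> carrier E. \<exists>g \<in> carrier E \<rightarrow> carrier D.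
        \<forall>d\<in>carrier D. \<forall>e\<in>carrier E. f d \<sqsubseteq>\<^bsub>E\<^esub> e \<longrightarrow> d \<sqsubseteq>\<^bsub>D\<^esub> g e)"

definition finite_subsets :: "'a set \<Rightarrow> 'a set gorder" where
  "finite_subsets S = \<lparr> carrier = Fpow S, eq = (=), le = (\<subseteq>) \<rparr>"

definition tukey_maximal :: "'a gorder \<Rightarrow> 'a set \<Rightarrow> bool" where
  "tukey_maximal B U \<longleftrightarrow>
     finite_subsets (carrier B) \<le>\<^sub>T inv_gorder (B\<lparr>carrier := U\<rparr>)"

end

(*
  If d = 2^omega, a transfinite recursion of length 2^omega through all double sequences r of
  elements of the Cohen algebra produces an ultrafilter V with the P-point property for all
  countable partitions: at each stage fewer than d conditions have been imposed, so some function
  is not dominated by the fewer than d functions which they determine, and it yields the next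
  element.

  Given more than kappa elements a_i of V, write some a_i as a countable join of cylinders such that
  each finite join of these cylinders lies below infinitely many of the a_j; this is possible as
  there are only kappa finite sets of cylinders, and it is the point where kappa < 2^omega is used.
  So a_i is the increasing join of elements q_n with q_n below b_n for distinct members b_n of the
  family. The P-point property gives B in V with B - b_n below some q_m, and after removing from B
  alternate differences of a sparse subsequence of the q_n, one is below infinitely many b_n. Hence
  infinitely many elements of every such family have a common lower bound in V, whereas a Tukey
  reduction from the finite subsets of the algebra would provide a family of size 2^omega without
  this property.
*)

theory Submission
  imports Defs
begin

section \<open>Cardinalities\<close>

lemma card_of_Fpow_le:
  assumes "infinite A"
  shows "|Fpow A| \<le>o |A|"
proof -
  have lists: "|{xs. set xs \<subseteq> A \<and> length xs = n}| \<le>o |A|" for n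
  proof (induction n)
    case 0
    have "{xs. set xs \<subseteq> A \<and> length xs = 0} = {[]}" by auto
    then show ?case
      using assms by (metis card_of_singl_ordLeq infinite_imp_nonempty)
  next
    case (Suc n)
    have "{xs. set xs \<subseteq> A \<and> length xs = Suc n}
        \<subseteq> (\<lambda>(x, xs). x # xs) ` (A \<times> {xs. set xs \<subseteq> A \<and> length xs = n})"
      by (auto simp: length_Suc_conv image_iff)
    then have "|{xs. set xs \<subseteq> A \<and> length xs = Suc n}| \<le>o |A \<times> {xs. set xs \<subseteq> A \<and> length xs = n}|"
      by (rule surj_imp_ordLeq)
    also have "|A \<times> {xs. set xs \<subseteq> A \<and> length xs = n}| \<le>o |A|"
      by (rule card_of_Times_ordLeq_infinite_Field)
        (use assms Suc card_of_card_order_on card_of_mono1 in \<open>auto simp: Field_card_of\<close>)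
    finally show ?case .
  qed
  have "Fpow A \<subseteq> set ` (\<Union>n. {xs. set xs \<subseteq> A \<and> length xs = n})"
    by (auto simp: Fpow_def image_iff) (metis finite_list)
  then have "|Fpow A| \<le>o |\<Union>n. {xs. set xs \<subseteq> A \<and> length xs = n}|"
    by (rule surj_imp_ordLeq)
  also have "|\<Union>n. {xs. set xs \<subseteq> A \<and> length xs = n}| \<le>o |A|"
    by (rule card_of_UNION_ordLeq_infinite[OF assms])
      (use assms lists infinite_iff_card_of_nat in auto)
  finally show ?thesis .
qed

lemma card_of_Fpow_ordLeq:
  assumes "|B| \<le>o |A|" "infinite A"
  shows "|Fpow B| \<le>o |A|"
proof (cases "finite B")
  case True
  then have "finite (Fpow B)" by (simp add: Fpow_Pow_finite)
  then show ?thesis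
    using assms(2) finite_ordLess_infinite card_of_Well_order Field_card_of ordLess_imp_ordLeq
    by metis
next
  case False
  then show ?thesis
    using assms(1) card_of_Fpow_le ordLeq_transitive by blast
qed

lemma card_of_Fpow_less:
  assumes "|A| <o |B|" "infinite B"
  shows "|Fpow A| <o |B|"
proof (cases "finite A")
  case True
  then have "finite (Fpow A)" by (simp add: Fpow_Pow_finite)
  then show ?thesis
    using assms(2) finite_ordLess_infinite card_of_Well_order Field_card_of by metis
next
  case False
  then show ?thesis
    using assms(1) card_of_Fpow_le ordLeq_ordLess_trans by blast
qed

text \<open>Trades the cardinal exponential of the theorem for a concrete set, against which all
  later bounds are stated.\<close>

lemma continuum_ordIso: "ctwo ^c natLeq =o |UNIV :: nat set set|"
proof -
  have "|Pow (UNIV :: nat set)| =o |Func (UNIV :: nat set) (UNIV :: bool set)|"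
    by (rule card_of_Pow_Func)
  then show ?thesis
    by (simp add: cexp_def ctwo_def Field_natLeq Field_card_of ordIso_symmetric)
qed

text \<open>The hypothesis on the dominating number enters the rest of the proof only in this
  form.\<close>

lemma not_dominating_family_of_small:
  assumes "dominating_number =o ctwo ^c natLeq" "|F| <o |UNIV :: nat set set|"
  shows "\<not> dominating_family F"
proof
  assume "dominating_family F"
  then have "dominating_number \<le>o |F|" by (rule dominating_number_least)
  then have "dominating_number <o |UNIV :: nat set set|"
    using assms(2) ordLeq_ordLess_trans by blast
  moreover have "dominating_number =o |UNIV :: nat set set|"
    using assms(1) continuum_ordIso ordIso_transitive by blast
  ultimately show False
    using not_ordLess_ordIso by blast
qed

lemma card_of_nat_sequences:
  assumes "|R| \<le>o |UNIV :: nat set set|"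
  shows "|{f :: nat \<Rightarrow> 'b. range f \<subseteq> R}| \<le>o |UNIV :: nat set set|"
proof (cases "R = {}")
  case True
  then have "{f :: nat \<Rightarrow> 'b. range f \<subseteq> R} = {}" by auto
  then show ?thesis by (metis card_of_empty)
next
  case False
  then obtain g :: "nat set \<Rightarrow> 'b" where g: "range g = R"
    using assms card_of_ordLeq2 by metis
  \<comment> \<open>\<open>G\<close> decodes: the \<open>k\<close>-th section of \<open>S\<close>
    under the pairing function is a name, read through \<open>g\<close>, of the \<open>k\<close>-th
    term. So one set of naturals carries a whole sequence.\<close>
  define G where "G S = (\<lambda>k. g {n. prod_encode (k, n) \<in> S})" for S
  have "f \<in> range G" if f: "range f \<subseteq> R" for f
  proof -
    have "\<forall>k. \<exists>S. f k = g S" using f g by blast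
    then obtain s where s: "\<And>k. f k = g (s k)" by metis
    have "G (prod_encode ` (SIGMA k:UNIV. s k)) = f"
      by (auto simp: G_def s image_iff)
    then show ?thesis by blast
  qed
  then have "{f. range f \<subseteq> R} \<subseteq> range G" by blast
  then show ?thesis by (rule surj_imp_ordLeq)
qed

lemma card_of_nat_double_sequences:
  assumes "|R| \<le>o |UNIV :: nat set set|"
  shows "|{r :: nat \<Rightarrow> nat \<Rightarrow> 'b. \<forall>k m. r k m \<in> R}| \<le>o |UNIV :: nat set set|"
proof -
  have "{r :: nat \<Rightarrow> nat \<Rightarrow> 'b. \<forall>k m. r k m \<in> R}
      \<subseteq> (\<lambda>f k m. f (prod_encode (k, m))) ` {f. range f \<subseteq> R}"
  proof
    fix r :: "nat \<Rightarrow> nat \<Rightarrow> 'b" assume "r \<in> {r. \<forall>k m. r k m \<in> R}"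
    then have "range (case_prod r \<circ> prod_decode) \<subseteq> R"
      by (auto split: prod.splits)
    moreover have "r = (\<lambda>k m. (case_prod r \<circ> prod_decode) (prod_encode (k, m)))"
      by simp
    ultimately show "r \<in> (\<lambda>f k m. f (prod_encode (k, m))) ` {f. range f \<subseteq> R}"
      by (intro image_eqI[where x = "case_prod r \<circ> prod_decode"]) auto
  qed
  then show ?thesis
    using surj_imp_ordLeq card_of_nat_sequences[OF assms] ordLeq_transitive by blast
qed

section \<open>P-ultrafilters modulo a sigma-ideal\<close>

text \<open>Sets modulo \<open>N\<close> stand in for elements of the quotient, so that countable
  joins are plain unions. Sets in \<open>N\<close> need not belong to \<open>M\<close>.\<close>

locale proper_sigma_ideal = sigma_algebra \<Omega> M for \<Omega> :: "'p set" and M +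
  fixes N :: "'p set set"
  assumes ideal_empty: "{} \<in> N"
    and ideal_subset: "\<And>X Y. X \<in> N \<Longrightarrow> Y \<subseteq> X \<Longrightarrow> Y \<in> N"
    and ideal_UN_nat: "\<And>X :: nat \<Rightarrow> 'p set. (\<And>n. X n \<in> N) \<Longrightarrow> (\<Union>n. X n) \<in> N"
    and ideal_proper: "\<Omega> \<notin> N"
begin

section \<open>Null sets and centred families\<close>

lemma ideal_UN:
  assumes "countable I" "\<And>i. i \<in> I \<Longrightarrow> X i \<in> N"
  shows "(\<Union>i\<in>I. X i) \<in> N"
proof (cases "I = {}")
  case False
  then have "(\<Union>i\<in>I. X i) = (\<Union>n. X (from_nat_into I n))"
    using assms(1) by (metis UN_extend_simps(10) range_from_nat_into)
  then show ?thesis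
    using ideal_UN_nat[of "\<lambda>n. X (from_nat_into I n)"] assms(2) False
    by (simp add: from_nat_into)
qed (simp add: ideal_empty)

lemma ideal_Un: "X \<in> N \<Longrightarrow> Y \<in> N \<Longrightarrow> X \<union> Y \<in> N"
  using ideal_UN[of "{X, Y}" id] by auto

text \<open>The finite intersection property modulo \<open>N\<close>. The factor
  \<open>\<Omega>\<close> gives the empty \<open>F\<close> the value \<open>\<Omega>\<close> instead
  of the whole type.\<close>

definition centred :: "'p set set \<Rightarrow> bool" where
  "centred S \<longleftrightarrow> (\<forall>F\<in>Fpow S. \<Omega> \<inter> \<Inter>F \<notin> N)"

lemma centredD: "centred S \<Longrightarrow> F \<in> Fpow S \<Longrightarrow> \<Omega> \<inter> \<Inter>F \<notin> N"
  by (simp add: centred_def)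

lemma centred_insert:
  assumes "\<And>F. F \<in> Fpow S \<Longrightarrow> (\<Omega> \<inter> \<Inter>F) \<inter> x \<notin> N"
  shows "centred (insert x S)"
  unfolding centred_def
proof
  fix F assume "F \<in> Fpow (insert x S)"
  then have "F - {x} \<in> Fpow S" by (auto simp: Fpow_def)
  then have "(\<Omega> \<inter> \<Inter>(F - {x})) \<inter> x \<notin> N" by (rule assms)
  then show "\<Omega> \<inter> \<Inter>F \<notin> N"
    by (rule contrapos_nn) (erule ideal_subset, blast)
qed

text \<open>
  The P-point alternatives, with \<open>r k m\<close> read as the \<open>m\<close>-th piece of the \<open>k\<close>-th block of a partition;
  disjointness is never required.
\<close>

definition selects :: "(nat \<Rightarrow> nat \<Rightarrow> 'p set) \<Rightarrow> 'p set \<Rightarrow> bool" where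
  "selects r x \<longleftrightarrow> (\<exists>k. x = (\<Union>m. r k m)) \<or> x = \<Omega> - (\<Union>k m. r k m) \<or>
     (\<exists>f. x = (\<Union>k. \<Union>m\<in>{..f k}. r k m))"

lemma selectsI:
  "selects r (\<Union>m. r k m)"
  "selects r (\<Omega> - (\<Union>k m. r k m))"
  "selects r (\<Union>k. \<Union>m\<in>{..f k}. r k m)"
  unfolding selects_def
  subgoal by (intro disjI1 exI[of _ k]) (rule refl)
  subgoal by (intro disjI2 disjI1) (rule refl)
  subgoal by (intro disjI2 exI[of _ f]) (rule refl)
  done

lemma selects_in_sets:
  assumes "selects r x" "\<And>k m. r k m \<in> M"
  shows "x \<in> M"
  using assms(1) unfolding selects_def
  by (elim disjE exE) (auto intro!: assms(2) countable_UN finite_UN Diff)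

text \<open>If some finite intersection from \<open>S\<close> meets almost all blocks in null sets,
  then a single block or the complement of all blocks can be added. Otherwise every finite
  intersection is positive on pieces of arbitrarily late blocks; this yields fewer than continuum
  many functions, and a function that none of them dominates tells how much of each block to
  keep.\<close>

lemma selective_extension:
  assumes small: "\<And>F :: (nat \<Rightarrow> nat) set. |F| <o |UNIV :: nat set set| \<Longrightarrow> \<not> dominating_family F"
    and S: "centred S" "|S| <o |UNIV :: nat set set|"
    and r: "\<And>k m. r k m \<in> M"
  shows "\<exists>x. selects r x \<and> centred (insert x S)"
proof (cases "\<exists>F\<in>Fpow S. \<exists>l. \<forall>k\<ge>l. (\<Omega> \<inter> \<Inter>F) \<inter> (\<Union>m. r k m) \<in> N")
  case True
  then obtain F l where F: "F \<in> Fpow S" "\<And>k. k \<ge> l \<Longrightarrow> (\<Omega> \<inter> \<Inter>F) \<inter> (\<Union>m. r k m) \<in> N" by auto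
  show ?thesis
  proof (rule ccontr)
    assume neg: "\<nexists>x. selects r x \<and> centred (insert x S)"
    have "\<exists>G\<in>Fpow S. (\<Omega> \<inter> \<Inter>G) \<inter> (\<Union>m. r k m) \<in> N" for k
    proof -
      have "\<not> centred (insert (\<Union>m. r k m) S)"
        using neg selectsI(1) by metis
      then show ?thesis using centred_insert[of S "\<Union>m. r k m"] by blast
    qed
    then obtain G where G: "\<And>k. G k \<in> Fpow S" "\<And>k. (\<Omega> \<inter> \<Inter>(G k)) \<inter> (\<Union>m. r k m) \<in> N"
      by metis
    have "\<not> centred (insert (\<Omega> - (\<Union>k m. r k m)) S)"
      using neg selectsI(2) by metis
    then obtain H where H: "H \<in> Fpow S" "(\<Omega> \<inter> \<Inter>H) \<inter> (\<Omega> - (\<Union>k m. r k m)) \<in> N"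
      using centred_insert[of S "\<Omega> - (\<Union>k m. r k m)"] by blast
    \<comment> \<open>One finite set merges the refutations of the complement and of the first
      \<open>l\<close> blocks with \<open>F\<close>, which takes care of the later blocks. Its
      intersection is then null, against \<open>centred S\<close>.\<close>
    define K where "K = F \<union> H \<union> (\<Union>k\<in>{..<l}. G k)"
    have "K \<in> Fpow S"
      using F(1) G(1) H(1) by (auto simp: Fpow_def K_def)
    have cover: "\<Omega> \<inter> \<Inter>K \<subseteq> (\<Union>k. (\<Omega> \<inter> \<Inter>K) \<inter> (\<Union>m. r k m)) \<union> (\<Omega> \<inter> \<Inter>H) \<inter> (\<Omega> - (\<Union>k m. r k m))"
      by (auto simp: K_def)
    have "(\<Omega> \<inter> \<Inter>K) \<inter> (\<Union>m. r k m) \<in> N" for k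
    proof (cases "k \<ge> l")
      case True
      show ?thesis
        by (rule ideal_subset[OF F(2)[OF True]]) (auto simp: K_def)
    next
      case False
      show ?thesis
        by (rule ideal_subset[OF G(2)[of k]]) (use False in \<open>auto simp: K_def\<close>)
    qed
    then have "\<Omega> \<inter> \<Inter>K \<in> N"
      by (rule ideal_subset[OF ideal_Un[OF ideal_UN_nat H(2)] cover])
    then show False
      using centredD[OF S(1) \<open>K \<in> Fpow S\<close>] by contradiction
  qed
next
  case False
  \<comment> \<open>A positive block has a positive piece because \<open>N\<close> is closed under
    countable unions.\<close>
  have "\<exists>k m. k \<ge> n \<and> (\<Omega> \<inter> \<Inter>F) \<inter> r k m \<notin> N" if F: "F \<in> Fpow S" for F n
  proof -
    obtain k where k: "k \<ge> n" "(\<Omega> \<inter> \<Inter>F) \<inter> (\<Union>m. r k m) \<notin> N"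
      using False F by (metis (no_types, lifting))
    have "(\<Omega> \<inter> \<Inter>F) \<inter> (\<Union>m. r k m) = (\<Union>m. (\<Omega> \<inter> \<Inter>F) \<inter> r k m)" by blast
    then show ?thesis
      using k ideal_UN_nat by metis
  qed
  then obtain K m where Km: "\<And>F n. F \<in> Fpow S \<Longrightarrow> K F n \<ge> n"
    "\<And>F n. F \<in> Fpow S \<Longrightarrow> (\<Omega> \<inter> \<Inter>F) \<inter> r (K F n) (m F n) \<notin> N"
    by metis
  have "|m ` Fpow S| <o |UNIV :: nat set set|"
    using card_of_image card_of_Fpow_less[OF S(2)] ordLeq_ordLess_trans
    by (metis Finite_Set.finite_set infinite_UNIV_nat)
  then have "\<not> dominating_family (m ` Fpow S)" by (rule small)
  then obtain g where g: "\<And>F. F \<in> Fpow S \<Longrightarrow> \<not> (\<forall>\<^sub>F n in sequentially. g n \<le> m F n)"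
    unfolding dominating_family_def by blast
  \<comment> \<open>The piece numbered \<open>m F n\<close> sits in the block
    \<open>K F n \<ge> n\<close>, not in block \<open>n\<close>. Summing makes \<open>f\<close> at
    least \<open>g n\<close> on every block from \<open>n\<close> on, so a single \<open>n\<close>
    with \<open>m F n < g n\<close> puts that piece inside \<open>x\<close>.\<close>
  define f where "f k = (\<Sum>i\<le>k. g i)" for k
  have f: "g n \<le> f k" if "n \<le> k" for n k
    unfolding f_def using that by (intro member_le_sum) auto
  define x where "x = (\<Union>k. \<Union>m\<in>{..f k}. r k m)"
  have "selects r x"
    unfolding x_def by (rule selectsI)
  moreover have "centred (insert x S)"
  proof (rule centred_insert)
    fix F assume F: "F \<in> Fpow S"
    from g[OF F] obtain n where n: "m F n < g n"
      by (metis (mono_tags, lifting) eventuallyI linorder_not_le)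
    have "m F n \<le> f (K F n)"
      using n f[OF Km(1)[OF F, of n]] by linarith
    then have "(\<Omega> \<inter> \<Inter>F) \<inter> r (K F n) (m F n) \<subseteq> (\<Omega> \<inter> \<Inter>F) \<inter> x"
      by (auto simp: x_def)
    then show "(\<Omega> \<inter> \<Inter>F) \<inter> x \<notin> N"
      using Km(2)[OF F] ideal_subset by blast
  qed
  ultimately show ?thesis by blast
qed

text \<open>
  The sequences in \<open>T\<close> are handled one after the other along a well-order of type \<open>|T|\<close>, so that
  fewer than continuum many sets have been chosen at every stage.
\<close>

lemma selective_centred_choice:
  assumes small: "\<And>F :: (nat \<Rightarrow> nat) set. |F| <o |UNIV :: nat set set| \<Longrightarrow> \<not> dominating_family F"
    and T: "|T| \<le>o |UNIV :: nat set set|" "\<And>r k m. r \<in> T \<Longrightarrow> r k m \<in> M"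
  shows "\<exists>h. (\<forall>r\<in>T. selects r (h r)) \<and> centred (h ` T)"
proof -
  define R where "R = |T| - Id"
  have WO: "Well_order |T|" by (rule card_of_Well_order)
  have wfR: "wf R"
    using WO by (simp add: R_def well_order_on_def)
  have FT: "Field |T| = T" by (rule Field_card_of)
  have below: "{y. (y, x) \<in> R} = underS ( |T| ) x" for x
    by (auto simp: R_def underS_def)
  have lin: "(x, y) \<in> R \<or> (y, x) \<in> R" if "x \<in> T" "y \<in> T" "x \<noteq> y" for x y
    using WO that FT unfolding R_def
    by (auto simp: well_order_on_def linear_order_on_def total_on_def)
  have RT: "x \<in> T \<and> y \<in> T" if "(x, y) \<in> R" for x y
    using that FT unfolding R_def Field_def by blast
  have trR: "(x, z) \<in> R" if "(x, y) \<in> R" "(y, z) \<in> R" for x y z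
  proof -
    have "trans |T|" "antisym |T|"
      using WO by (auto simp: well_order_on_def linear_order_on_def partial_order_on_def preorder_on_def)
    then show ?thesis
      using that unfolding R_def by (blast dest: transD antisymD)
  qed
  \<comment> \<open>A finite set of stages has a last one, which is what lets \<open>cent\<close>
    reduce any finite intersection to the condition imposed at a single stage.\<close>
  have Max: "\<exists>y\<in>F. \<forall>z\<in>F. z = y \<or> (z, y) \<in> R" if "finite F" "F \<noteq> {}" "F \<subseteq> T" for F
    using that
  proof (induction F rule: finite_ne_induct)
    case (insert x F)
    then obtain y where y: "y \<in> F" "\<forall>z\<in>F. z = y \<or> (z, y) \<in> R" by auto
    then have "x \<in> T" "y \<in> T" "x \<noteq> y" using insert by auto
    with lin consider "(x, y) \<in> R" | "(y, x) \<in> R" by blast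
    then show ?case
    proof cases
      case 1
      then show ?thesis using y by blast
    next
      case 2
      then show ?thesis using y trR[OF _ 2] by (intro bexI[of _ x]) auto
    qed
  qed auto
  \<comment> \<open>The guard \<open>x \<in> T\<close> is there because the recursion principle asks
    for a value at every point of the type.\<close>
  define P where "P h x s \<longleftrightarrow> (x \<in> T \<longrightarrow> selects x s \<and> centred (insert s (h ` {y. (y, x) \<in> R})))"
    for h x s
  have cent: "centred (h ` Y)"
    if Y: "Y \<subseteq> T" and PY: "\<And>y. y \<in> Y \<Longrightarrow> P h y (h y)" for h Y
    unfolding centred_def
  proof
    fix F assume "F \<in> Fpow (h ` Y)"
    then obtain G where G: "G \<subseteq> Y" "finite G" "F = h ` G"
      by (auto simp: Fpow_def dest: finite_subset_image)
    show "\<Omega> \<inter> \<Inter>F \<notin> N"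
    proof (cases "G = {}")
      case True
      then show ?thesis using G(3) ideal_proper by simp
    next
      case False
      then obtain y where y: "y \<in> G" "\<forall>z\<in>G. z = y \<or> (z, y) \<in> R"
        using Max[OF G(2) False subset_trans[OF G(1) Y]] by auto
      then have "y \<in> Y" "y \<in> T" using G(1) Y by auto
      then have "centred (insert (h y) (h ` {z. (z, y) \<in> R}))"
        using PY[of y] unfolding P_def by simp
      moreover have "F \<in> Fpow (insert (h y) (h ` {z. (z, y) \<in> R}))"
        using G y(2) by (auto simp: Fpow_def)
      ultimately show ?thesis by (rule centredD)
    qed
  qed
  have "\<exists>h. \<forall>x. P h x (h x)"
  proof (rule dependent_wf_choice[OF wfR])
    fix f g :: "(nat \<Rightarrow> nat \<Rightarrow> 'p set) \<Rightarrow> 'p set" and x s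
    assume "\<And>z. (z, x) \<in> R \<Longrightarrow> f z = g z"
    then have "f ` {y. (y, x) \<in> R} = g ` {y. (y, x) \<in> R}" by auto
    then show "P f x s = P g x s" by (simp add: P_def)
  next
    fix x h assume IH: "\<And>y. (y, x) \<in> R \<Longrightarrow> P h y (h y)"
    show "\<exists>s. P h x s"
    proof (cases "x \<in> T")
      case True
      have "|h ` {y. (y, x) \<in> R}| \<le>o |underS ( |T| ) x|"
        unfolding below by (rule card_of_image)
      \<comment> \<open>Proper initial segments of the cardinal \<open>|T|\<close> are smaller than
        \<open>T\<close>, so fewer than continuum many sets were chosen before
        \<open>x\<close>.\<close>
      moreover have "|underS ( |T| ) x| <o |T|"
        using True by (intro card_of_underS) (auto simp: card_of_card_order_on Field_card_of)
      ultimately have "|h ` {y. (y, x) \<in> R}| <o |UNIV :: nat set set|"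
        using T(1) ordLeq_ordLess_trans ordLess_ordLeq_trans by blast
      moreover have "centred (h ` {y. (y, x) \<in> R})"
        by (rule cent) (use IH RT in auto)
      ultimately show ?thesis
        using selective_extension[OF small] T(2)[OF True] unfolding P_def by blast
    qed (simp add: P_def)
  qed
  then obtain h where h: "\<And>x. P h x (h x)" by blast
  then have "centred (h ` T)" by (intro cent) auto
  then show ?thesis using h unfolding P_def by blast
qed

section \<open>Existence of P-ultrafilters\<close>

text \<open>The set-level picture of an ultrafilter on the quotient. The clause on
  \<open>X - Y \<in> N\<close> gives upward closure and invariance under changes modulo
  \<open>N\<close> at once; the last clause is the P-point property.\<close>

definition p_ultrafilter :: "'p set set \<Rightarrow> bool" where
  "p_ultrafilter V \<longleftrightarrow> V \<subseteq> M \<and> V \<inter> N = {} \<and> (\<forall>X\<in>V. \<forall>Y\<in>V. X \<inter> Y \<in> V) \<and>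
     (\<forall>X\<in>V. \<forall>Y\<in>M. X - Y \<in> N \<longrightarrow> Y \<in> V) \<and> (\<forall>X\<in>M. X \<in> V \<or> \<Omega> - X \<in> V) \<and>
     (\<forall>r. (\<forall>k m. r k m \<in> M) \<longrightarrow> (\<exists>x\<in>V. selects r x))"

lemma p_ultrafilterD:
  assumes "p_ultrafilter V"
  shows "\<And>X. X \<in> V \<Longrightarrow> X \<in> M" "\<And>X. X \<in> V \<Longrightarrow> X \<notin> N"
    "\<And>X Y. X \<in> V \<Longrightarrow> Y \<in> V \<Longrightarrow> X \<inter> Y \<in> V"
    "\<And>X Y. X \<in> V \<Longrightarrow> Y \<in> M \<Longrightarrow> X - Y \<in> N \<Longrightarrow> Y \<in> V"
    "\<And>X. X \<in> M \<Longrightarrow> X \<in> V \<or> \<Omega> - X \<in> V"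
    "\<And>r. (\<And>k m. r k m \<in> M) \<Longrightarrow> \<exists>x\<in>V. selects r x"
proof -
  from assms have A: "V \<subseteq> M" "V \<inter> N = {}" "\<forall>X\<in>V. \<forall>Y\<in>V. X \<inter> Y \<in> V"
    "\<forall>X\<in>V. \<forall>Y\<in>M. X - Y \<in> N \<longrightarrow> Y \<in> V" "\<forall>X\<in>M. X \<in> V \<or> \<Omega> - X \<in> V"
    and sel: "\<forall>r. (\<forall>k m. r k m \<in> M) \<longrightarrow> (\<exists>x\<in>V. selects r x)"
    unfolding p_ultrafilter_def by - (elim conjE, assumption)+
  show "\<And>X. X \<in> V \<Longrightarrow> X \<in> M" "\<And>X. X \<in> V \<Longrightarrow> X \<notin> N"
    "\<And>X Y. X \<in> V \<Longrightarrow> Y \<in> V \<Longrightarrow> X \<inter> Y \<in> V"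
    "\<And>X Y. X \<in> V \<Longrightarrow> Y \<in> M \<Longrightarrow> X - Y \<in> N \<Longrightarrow> Y \<in> V"
    "\<And>X. X \<in> M \<Longrightarrow> X \<in> V \<or> \<Omega> - X \<in> V"
    using A by blast+
  show "\<exists>x\<in>V. selects r x" if "\<And>k m. r k m \<in> M" for r
    using sel that by simp
qed

text \<open>Lets the transfinite choice treat only sequences of representatives: the same
  alternative for \<open>r\<close> differs from the one for \<open>s\<close> by countably many null
  sets.\<close>

lemma selects_cong_ideal:
  assumes eq: "\<And>k m. s k m - r k m \<in> N" "\<And>k m. r k m - s k m \<in> N" and x: "selects s x"
  shows "\<exists>y. selects r y \<and> x - y \<in> N"
proof -
  have I: "(\<Union>k. \<Union>m. s k m - r k m) \<in> N" "(\<Union>k. \<Union>m. r k m - s k m) \<in> N"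
    by (intro ideal_UN_nat eq)+
  from x consider k where "x = (\<Union>m. s k m)" | "x = \<Omega> - (\<Union>k m. s k m)"
    | f where "x = (\<Union>k. \<Union>m\<in>{..f k}. s k m)"
    unfolding selects_def by blast
  then show ?thesis
  proof cases
    case (1 k)
    have "x - (\<Union>m. r k m) \<in> N"
      unfolding 1 by (rule ideal_subset[OF I(1)]) blast
    then show ?thesis using selectsI(1) by blast
  next
    case 2
    have "x - (\<Omega> - (\<Union>k m. r k m)) \<in> N"
      unfolding 2 by (rule ideal_subset[OF I(2)]) blast
    then show ?thesis using selectsI(2) by blast
  next
    case (3 f)
    have "x - (\<Union>k. \<Union>m\<in>{..f k}. r k m) \<in> N"
      unfolding 3 by (rule ideal_subset[OF I(1)]) blast
    then show ?thesis using selectsI(3)[of r f] by blast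
  qed
qed

text \<open>Only the representatives in \<open>R\<close> have to be counted, not \<open>M\<close>.
  The sets chosen for all double sequences in \<open>R\<close> generate a filter modulo
  \<open>N\<close>, and its being an ultrafilter is itself an instance of selection.\<close>

lemma ex_p_ultrafilter:
  assumes small: "\<And>F :: (nat \<Rightarrow> nat) set. |F| <o |UNIV :: nat set set| \<Longrightarrow> \<not> dominating_family F"
    and R: "|R| \<le>o |UNIV :: nat set set|" "R \<subseteq> M"
    and rep: "\<And>X. X \<in> M \<Longrightarrow> \<exists>Y\<in>R. X - Y \<in> N \<and> Y - X \<in> N"
  shows "\<exists>V. p_ultrafilter V"
proof -
  define T where "T = {r :: nat \<Rightarrow> nat \<Rightarrow> 'p set. \<forall>k m. r k m \<in> R}"
  have T: "r k m \<in> M" if "r \<in> T" for r k m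
    using that R(2) by (auto simp: T_def)
  obtain h where h: "\<And>r. r \<in> T \<Longrightarrow> selects r (h r)" "centred (h ` T)"
    using selective_centred_choice[OF small card_of_nat_double_sequences[OF R(1)]] T
    unfolding T_def by blast
  define V where "V = {X\<in>M. \<exists>F\<in>Fpow (h ` T). (\<Omega> \<inter> \<Inter>F) - X \<in> N}"
  have ideal: "X \<notin> N" if X: "X \<in> V" for X
  proof
    assume "X \<in> N"
    obtain F where F: "F \<in> Fpow (h ` T)" "(\<Omega> \<inter> \<Inter>F) - X \<in> N"
      using X by (auto simp: V_def)
    have "\<Omega> \<inter> \<Inter>F \<in> N"
      by (rule ideal_subset[OF ideal_Un[OF F(2) \<open>X \<in> N\<close>]]) blast
    then show False
      using centredD[OF h(2) F(1)] by contradiction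
  qed
  have int: "X \<inter> Y \<in> V" if X: "X \<in> V" and Y: "Y \<in> V" for X Y
  proof -
    obtain F where F: "F \<in> Fpow (h ` T)" "(\<Omega> \<inter> \<Inter>F) - X \<in> N"
      using X by (auto simp: V_def)
    obtain G where G: "G \<in> Fpow (h ` T)" "(\<Omega> \<inter> \<Inter>G) - Y \<in> N"
      using Y by (auto simp: V_def)
    have "(\<Omega> \<inter> \<Inter>(F \<union> G)) - X \<inter> Y \<in> N"
      by (rule ideal_subset[OF ideal_Un[OF F(2) G(2)]]) blast
    moreover have "F \<union> G \<in> Fpow (h ` T)"
      using F(1) G(1) by (auto simp: Fpow_def)
    ultimately show ?thesis
      using X Y by (auto simp: V_def)
  qed
  have up: "Y \<in> V" if X: "X \<in> V" and Y: "Y \<in> M" "X - Y \<in> N" for X Y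
  proof -
    obtain F where F: "F \<in> Fpow (h ` T)" "(\<Omega> \<inter> \<Inter>F) - X \<in> N"
      using X by (auto simp: V_def)
    have "(\<Omega> \<inter> \<Inter>F) - Y \<in> N"
      by (rule ideal_subset[OF ideal_Un[OF F(2) Y(2)]]) blast
    then show ?thesis
      using F(1) Y(1) by (auto simp: V_def)
  qed
  have sel: "\<exists>x\<in>V. selects r x" if r: "\<And>k m. r k m \<in> M" for r
  proof -
    obtain s where s: "\<And>k m. s k m \<in> R" "\<And>k m. s k m - r k m \<in> N" "\<And>k m. r k m - s k m \<in> N"
      using rep[OF r] by metis
    then have "s \<in> T" by (simp add: T_def)
    then have "h s \<in> M" using selects_in_sets h(1) T by blast
    moreover have "{h s} \<in> Fpow (h ` T)" using \<open>s \<in> T\<close> by (simp add: Fpow_def)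
    moreover have "(\<Omega> \<inter> \<Inter>{h s}) - h s \<in> N" using ideal_empty by (simp add: Diff_eq)
    ultimately have "h s \<in> V" unfolding V_def by blast
    moreover obtain y where y: "selects r y" "h s - y \<in> N"
      using selects_cong_ideal[OF s(2,3) h(1)[OF \<open>s \<in> T\<close>]] by blast
    moreover have "y \<in> M" using selects_in_sets[OF y(1) r] .
    ultimately show ?thesis using up by blast
  qed
  have ultra: "X \<in> V \<or> \<Omega> - X \<in> V" if X: "X \<in> M" for X
  proof -
    \<comment> \<open>With one block whose pieces all equal \<open>X\<close> and all other blocks
      empty, the alternatives shrink to \<open>X\<close>, its complement and the empty set; the last
      is null.\<close>
    define r where "r k m = (if k = 0 then X else {})" for k m :: nat
    have "r k m \<in> M" for k m using X by (simp add: r_def)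
    then obtain x where x: "x \<in> V" "selects r x" using sel by blast
    have "(\<Union>m. r k m) = (if k = 0 then X else {})" for k by (auto simp: r_def)
    moreover have "(\<Union>k m. r k m) = X" "(\<Union>k. \<Union>m\<in>{..f k}. r k m) = X" for f
      by (auto simp: r_def split: if_splits)
    ultimately have "x = X \<or> x = {} \<or> x = \<Omega> - X"
      using x(2) unfolding selects_def by (auto split: if_splits)
    then show ?thesis using x(1) ideal ideal_empty by blast
  qed
  have "p_ultrafilter V"
    unfolding p_ultrafilter_def
  proof (intro conjI allI impI ballI)
    show "V \<subseteq> M" by (auto simp: V_def)
    show "V \<inter> N = {}" using ideal by blast
    show "\<exists>x\<in>V. selects r x" if "\<forall>k m. r k m \<in> M" for r
      using sel[of r] that by simp
  qed (use int up ultra in simp_all)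
  then show ?thesis by blast
qed

section \<open>Common lower bounds of infinitely many members\<close>

text \<open>The P-point property is applied to the pieces that \<open>q\<close> cuts from the
  successive differences of the decreasing intersections of the \<open>b n\<close>. It bounds each
  \<open>B - b n\<close> by some later \<open>q (G n)\<close>, whereas only \<open>q n - b n\<close>
  is known to be null; passing to a sparse subsequence and deciding a set \<open>E\<close> of
  alternate differences closes this gap.\<close>

lemma p_ultrafilter_infinite_bounded_subsequence:
  assumes V: "p_ultrafilter V"
    and b: "\<And>n :: nat. b n \<in> V"
    and q: "\<And>n. q n \<in> M" "incseq q" "(\<Union>n. q n) \<in> V" "\<And>n. q n - b n \<in> N"
  shows "\<exists>e\<in>V. infinite {n. e - b n \<in> N}"
proof -
  note VM = p_ultrafilterD(1)[OF V] and VN = p_ultrafilterD(2)[OF V] and Vint = p_ultrafilterD(3)[OF V]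
  define C where "C n = \<Omega> \<inter> (\<Inter>k<n. b k)" for n
  have "\<Omega> \<in> V"
    using p_ultrafilterD(4)[OF V b[of 0], of \<Omega>] VM[OF b[of 0]] sets_into_space ideal_empty
    by (metis Diff_eq_empty_iff top)
  have CV: "C n \<in> V" for n
  proof (induction n)
    case (Suc n)
    have "C (Suc n) = C n \<inter> b n" by (auto simp: C_def lessThan_Suc)
    then show ?case using Suc b Vint by simp
  qed (use \<open>\<Omega> \<in> V\<close> in \<open>simp add: C_def\<close>)
  have Cb: "C (Suc n) \<subseteq> b n" for n by (auto simp: C_def)
  \<comment> \<open>Since \<open>C 0 = \<Omega>\<close>, a point missing from \<open>C n\<close>
    drops out between two consecutive stages.\<close>
  have leave: "\<exists>k<n. x \<in> C k - C (Suc k)" if x: "x \<in> \<Omega>" "x \<notin> C n" for x n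
  proof -
    define l where "l = (LEAST k. x \<notin> C k)"
    have "x \<notin> C l" unfolding l_def using x(2) by (rule LeastI)
    moreover have "l \<le> n" unfolding l_def using x(2) by (rule Least_le)
    moreover have "l \<noteq> 0" using \<open>x \<notin> C l\<close> x(1) by (auto simp: C_def)
    moreover have "x \<in> C k" if "k < l" for k
      using not_less_Least[OF that[unfolded l_def]] by simp
    ultimately show ?thesis
      by (metis DiffI Suc_le_eq less_Suc_eq not0_implies_Suc)
  qed
  define r where "r k m = q m \<inter> (C k - C (Suc k))" for k m
  have "r k m \<in> M" for k m
    unfolding r_def using q(1) CV VM by (intro Int Diff) auto
  then obtain B where B: "B \<in> V" "selects r B"
    using p_ultrafilterD(6)[OF V] by blast
  from B(2) consider k where "B = (\<Union>m. r k m)" | "B = \<Omega> - (\<Union>k m. r k m)"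
    | f where "B = (\<Union>k. \<Union>m\<in>{..f k}. r k m)"
    unfolding selects_def by blast
  then show ?thesis
  proof cases
    \<comment> \<open>Impossible: a single block is disjoint from \<open>C (Suc k)\<close>, a member
      of \<open>V\<close>.\<close>
    case (1 k)
    then have "B \<inter> C (Suc k) = {}" by (auto simp: r_def)
    then show ?thesis
      using Vint[OF B(1) CV] VN ideal_empty by metis
  next
    \<comment> \<open>Points of \<open>B\<close> lying in some \<open>q m\<close> never leave the
      decreasing sequence, so the meet lies below every \<open>b n\<close>.\<close>
    case 2
    have bound: "(\<Union>n. q n) \<inter> B - b n = {}" for n
    proof -
      have "x \<in> b n" if x: "x \<in> q m" "x \<in> B" for x m
      proof (rule ccontr)
        assume "x \<notin> b n"
        then have "x \<notin> C (Suc n)" using Cb by blast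
        moreover have "x \<in> \<Omega>" using x(2) 2 by blast
        ultimately obtain k where "x \<in> C k - C (Suc k)" using leave by blast
        then have "x \<in> r k m" using x(1) by (simp add: r_def)
        then show False using x(2) 2 by blast
      qed
      then show ?thesis by blast
    qed
    have "{n. (\<Union>n. q n) \<inter> B - b n \<in> N} = UNIV"
      unfolding bound using ideal_empty by simp
    then show ?thesis
      using Vint[OF q(3) B(1)] by (metis infinite_UNIV_nat)
  next
    case (3 f)
    \<comment> \<open>The sum bounds \<open>f k\<close> for all \<open>k \<le> n\<close>, the only
      blocks of \<open>B\<close> that reach outside \<open>b n\<close>. The summand
      \<open>n + 1\<close> forces \<open>G n > n\<close>, so that iterating \<open>G\<close> gives a
      strictly increasing sequence.\<close>
    define G where "G n = n + (\<Sum>k\<le>n. f k) + 1" for n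
    have BG: "B - b n \<subseteq> q (G n)" for n
    proof
      fix x assume x: "x \<in> B - b n"
      then have "x \<in> (\<Union>k. \<Union>m\<in>{..f k}. r k m)" using 3 by simp
      then obtain k m where km: "m \<le> f k" "x \<in> q m" "x \<in> C k"
        unfolding r_def by blast
      have "x \<in> C (Suc n)" if "n < k"
        using km(3) that by (auto simp: C_def)
      then have "k \<le> n" using x Cb[of n] by (meson DiffD2 not_less subsetD)
      then have "f k \<le> (\<Sum>k\<le>n. f k)" by (intro member_le_sum) auto
      then have "m \<le> G n" using km(1) by (simp add: G_def)
      then show "x \<in> q (G n)" using km(2) q(2) by (auto simp: incseq_def)
    qed
    define s where "s k = (G ^^ k) 0" for k
    have s_Suc: "s (Suc k) = G (s k)" for k by (simp add: s_def)
    have s_mono: "strict_mono s"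
      by (rule strict_monoI_Suc) (simp add: s_Suc G_def)
    have q_mono: "q (s i) \<subseteq> q (s j)" if "i \<le> j" for i j
      using that q(2) s_mono by (simp add: incseq_def strict_mono_less_eq)
    have bound: "B - b (s k) \<subseteq> q (s (Suc k))" for k
      using BG s_Suc by simp
    \<comment> \<open>It suffices to push \<open>e - b n\<close> into \<open>q n\<close>, at the
      same index \<open>n\<close>, for infinitely many \<open>n\<close>: then it is null by
      hypothesis.\<close>
    have inf: "infinite {n. e - b n \<in> N}"
      if e: "\<And>k. e - b (s (g k)) \<subseteq> q (s (g k)) - b (s (g k))" and g: "strict_mono g"
      for e and g :: "nat \<Rightarrow> nat"
    proof -
      have "range (s \<circ> g) \<subseteq> {n. e - b n \<in> N}"
        using ideal_subset[OF q(4) e] by auto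
      moreover have "inj (s \<circ> g)"
        by (intro inj_compose strict_mono_imp_inj_on s_mono g)
      ultimately show ?thesis
        by (metis infinite_super range_inj_infinite)
    qed
    \<comment> \<open>Off \<open>E\<close>, the step from \<open>q (s (2 * k))\<close> to
      \<open>q (s (2 * k + 1))\<close> adds nothing, which serves the even indices. Inside
      \<open>E\<close>, the step from \<open>q (s (2 * k + 1))\<close> to
      \<open>q (s (2 * k + 2))\<close> adds nothing, which serves the odd ones.\<close>
    define E where "E = (\<Union>k. q (s (2 * k + 1)) - q (s (2 * k)))"
    have "E \<in> M" unfolding E_def using q(1) by (intro countable_UN) auto
    then consider "\<Omega> - E \<in> V" | "E \<in> V" using p_ultrafilterD(5)[OF V, of E] by blast
    then show ?thesis
    proof cases
      case 1
      have "B \<inter> (\<Omega> - E) - b (s (2 * k)) \<subseteq> q (s (2 * k)) - b (s (2 * k))" for k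
        using bound[of "2 * k"] by (auto simp: E_def)
      then have "infinite {n. B \<inter> (\<Omega> - E) - b n \<in> N}"
        by (rule inf[where g = "\<lambda>k. 2 * k"]) (simp add: strict_mono_def)
      then show ?thesis by (rule bexI[OF _ Vint[OF B(1) 1]])
    next
      case 2
      have "B \<inter> E - b (s (2 * k + 1)) \<subseteq> q (s (2 * k + 1)) - b (s (2 * k + 1))" for k
      proof
        fix x assume x: "x \<in> B \<inter> E - b (s (2 * k + 1))"
        then have "x \<in> E" by simp
        then obtain l where l: "x \<in> q (s (2 * l + 1))" "x \<notin> q (s (2 * l))"
          unfolding E_def by blast
        have "x \<in> q (s (2 * k + 2))" using x bound[of "2 * k + 1"] by auto
        then have "\<not> 2 * k + 2 \<le> 2 * l" using l(2) q_mono[of "2 * k + 2" "2 * l"] by blast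
        then have "2 * l + 1 \<le> 2 * k + 1" by simp
        then show "x \<in> q (s (2 * k + 1)) - b (s (2 * k + 1))"
          using l(1) q_mono[of "2 * l + 1" "2 * k + 1"] x by blast
      qed
      then have "infinite {n. B \<inter> E - b n \<in> N}"
        by (rule inf[where g = "\<lambda>k. 2 * k + 1"]) (simp add: strict_mono_def)
      then show ?thesis by (rule bexI[OF _ Vint[OF B(1) 2]])
    qed
  qed
qed

text \<open>There are at most \<open>|K|\<close> finite subsets of \<open>D\<close>, fewer than
  indices. Hence some \<open>a i\<close> is such that every finite union from \<open>D\<close> below
  it lies below infinitely many \<open>a j\<close>. Writing \<open>a i\<close> as a countable union
  from \<open>D\<close> gives the increasing sequence for the preceding lemma.\<close>

lemma p_ultrafilter_infinite_bounded_subfamily: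
  assumes V: "p_ultrafilter V"
    and D: "D \<subseteq> M" "|Fpow D| \<le>o |K|" "infinite K"
    and dense: "\<And>X. X \<in> M \<Longrightarrow> \<exists>d. range d \<subseteq> D \<and> X - (\<Union>n :: nat. d n) \<in> N \<and> (\<Union>n. d n) - X \<in> N"
    and a: "\<And>i. i \<in> I \<Longrightarrow> a i \<in> V" "|K| <o |I|"
  shows "\<exists>e\<in>V. infinite {i\<in>I. e - a i \<in> N}"
proof -
  define A where "A F = {i\<in>I. \<Union>F - a i \<in> N}" for F
  \<comment> \<open>The bad indices, those lying in some finite \<open>A F\<close>, form a union of
    at most \<open>|K|\<close> finite sets.\<close>
  have "|\<Union>F\<in>{F \<in> Fpow D. finite (A F)}. A F| \<le>o |K|"
  proof (rule card_of_UNION_ordLeq_infinite[OF D(3)])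
    show "|{F \<in> Fpow D. finite (A F)}| \<le>o |K|"
      using card_of_mono1[of "{F \<in> Fpow D. finite (A F)}" "Fpow D"] D(2) ordLeq_transitive by blast
    show "\<forall>F\<in>{F \<in> Fpow D. finite (A F)}. |A F| \<le>o |K|"
      using D(3) by (auto intro!: ordLess_imp_ordLeq finite_ordLess_infinite
          card_of_Well_order simp: Field_card_of)
  qed
  then have "\<not> I \<subseteq> (\<Union>F\<in>{F \<in> Fpow D. finite (A F)}. A F)"
    using a(2) card_of_mono1 not_ordLess_ordLeq ordLeq_transitive by blast
  then obtain i where i: "i \<in> I" "\<And>F. F \<in> Fpow D \<Longrightarrow> i \<in> A F \<Longrightarrow> infinite (A F)" by blast
  obtain d where d: "range d \<subseteq> D" "a i - (\<Union>n :: nat. d n) \<in> N" "(\<Union>n. d n) - a i \<in> N"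
    using dense p_ultrafilterD(1)[OF V a(1)[OF i(1)]] by metis
  define q where "q n = \<Union>(d ` {..n})" for n
  have "infinite (A (d ` {..n}))" for n
  proof (rule i(2))
    show "d ` {..n} \<in> Fpow D" using d(1) by (auto simp: Fpow_def)
    have "\<Union>(d ` {..n}) - a i \<in> N" by (rule ideal_subset[OF d(3)]) blast
    then show "i \<in> A (d ` {..n})" using i(1) by (simp add: A_def)
  qed
  then have inf: "infinite {i\<in>I. q n - a i \<in> N}" for n
    by (simp add: A_def q_def)
  \<comment> \<open>Avoiding the earlier values makes \<open>j\<close> injective, so that infinitely
    many \<open>n\<close> later give infinitely many indices.\<close>
  have "\<exists>j. \<forall>n. j n \<in> {i\<in>I. q n - a i \<in> N} - j ` {..<n}"
  proof (rule dependent_wellorder_choice[where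
        P = "\<lambda>f n i. i \<in> {i\<in>I. q n - a i \<in> N} - f ` {..<n}"])
    fix i n and f g :: "nat \<Rightarrow> 'b"
    assume "\<And>m. m < n \<Longrightarrow> f m = g m"
    then have "f ` {..<n} = g ` {..<n}" by auto
    then show "(i \<in> {i\<in>I. q n - a i \<in> N} - f ` {..<n}) = (i \<in> {i\<in>I. q n - a i \<in> N} - g ` {..<n})"
      by simp
  next
    fix f :: "nat \<Rightarrow> 'b" and n
    have "infinite ({i\<in>I. q n - a i \<in> N} - f ` {..<n})"
      by (rule Diff_infinite_finite[OF _ inf]) simp
    then show "\<exists>i. i \<in> {i\<in>I. q n - a i \<in> N} - f ` {..<n}"
      using infinite_imp_nonempty by blast
  qed
  then obtain j where "\<And>n. j n \<in> {i\<in>I. q n - a i \<in> N} - j ` {..<n}" by auto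
  then have j: "j n \<in> I" "q n - a (j n) \<in> N" "j n \<notin> j ` {..<n}" for n by blast+
  have inj: "inj j"
  proof (rule linorder_injI)
    fix m n :: nat assume "m < n"
    then have "j m \<in> j ` {..<n}" by simp
    then show "j m \<noteq> j n" using j(3)[of n] by metis
  qed
  have "\<exists>e\<in>V. infinite {n. e - a (j n) \<in> N}"
  proof (rule p_ultrafilter_infinite_bounded_subsequence[OF V])
    show "a (j n) \<in> V" for n using a(1) j(1) .
    show "q n \<in> M" for n unfolding q_def using d(1) D(1) by (intro finite_UN) auto
    show "incseq q" by (force simp: q_def incseq_def)
    show "(\<Union>n. q n) \<in> V"
    proof (rule p_ultrafilterD(4)[OF V a(1)[OF i(1)]])
      show "(\<Union>n. q n) \<in> M" using \<open>\<And>n. q n \<in> M\<close> by (intro countable_UN) auto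
      show "a i - (\<Union>n. q n) \<in> N"
        by (rule ideal_subset[OF d(2)]) (auto simp: q_def)
    qed
  qed (rule j(2))
  then obtain e where e: "e \<in> V" "infinite {n. e - a (j n) \<in> N}" by blast
  have "j ` {n. e - a (j n) \<in> N} \<subseteq> {i\<in>I. e - a i \<in> N}" using j(1) by auto
  moreover have "infinite (j ` {n. e - a (j n) \<in> N})"
    using e(2) inj by (meson finite_imageD inj_on_subset subset_UNIV)
  ultimately show ?thesis using e(1) finite_subset by blast
qed

end

section \<open>The meagre ideal\<close>

text \<open>\<open>F\<close> and \<open>P\<close> may overlap, so over a nonempty \<open>A\<close>
  the empty set is a cylinder as well; it later pads countable unions into sequences.\<close>

definition cyl :: "'a set \<Rightarrow> 'a set \<Rightarrow> 'a set \<Rightarrow> ('a \<Rightarrow> bool) set" where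
  "cyl A F P = {f \<in> extensional A. (\<forall>i\<in>F. f i) \<and> (\<forall>i\<in>P. \<not> f i)}"

definition cylinders :: "'a set \<Rightarrow> ('a \<Rightarrow> bool) set set" where
  "cylinders A = (\<lambda>(F, P). cyl A F P) ` (Fpow A \<times> Fpow A)"

lemma topspace_cantor_space: "topspace (cantor_space A) = extensional A"
  by (simp add: cantor_space_def PiE_def)

lemma cyl_in_cylinders: "F \<in> Fpow A \<Longrightarrow> P \<in> Fpow A \<Longrightarrow> cyl A F P \<in> cylinders A"
  by (force simp: cylinders_def)

lemma empty_in_cylinders:
  assumes "A \<noteq> {}"
  shows "{} \<in> cylinders A"
proof -
  obtain i where "i \<in> A" using assms by blast
  then have "cyl A {i} {i} \<in> cylinders A" by (intro cyl_in_cylinders) (auto simp: Fpow_def)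
  moreover have "cyl A {i} {i} = {}" by (auto simp: cyl_def)
  ultimately show ?thesis by simp
qed

lemma openin_cantor_space:
  "openin (cantor_space A) S \<longleftrightarrow>
     S \<subseteq> extensional A \<and> (\<forall>x\<in>S. \<exists>C\<in>cylinders A. x \<in> C \<and> C \<subseteq> S)"
proof
  assume op: "openin (cantor_space A) S"
  then have sub: "S \<subseteq> extensional A"
    using openin_subset topspace_cantor_space by metis
  moreover have "\<exists>C\<in>cylinders A. x \<in> C \<and> C \<subseteq> S" if x: "x \<in> S" for x
  proof -
    obtain U where U: "finite {i \<in> A. U i \<noteq> (UNIV :: bool set)}" "x \<in> Pi\<^sub>E A U" "Pi\<^sub>E A U \<subseteq> S"
      using op x unfolding cantor_space_def openin_product_topology_alt by auto
    define J where "J = {i \<in> A. U i \<noteq> UNIV}"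
    \<comment> \<open>The values of \<open>x\<close> on the finitely many constrained coordinates
      are frozen.\<close>
    let ?C = "cyl A {i \<in> J. x i} {i \<in> J. \<not> x i}"
    have "?C \<in> cylinders A"
      using U(1) by (intro cyl_in_cylinders) (auto simp: J_def Fpow_def intro: finite_subset[OF _ U(1)])
    moreover have "x \<in> ?C" using x sub by (auto simp: cyl_def)
    moreover have "?C \<subseteq> Pi\<^sub>E A U"
    proof
      fix f assume f: "f \<in> ?C"
      have "f i \<in> U i" if i: "i \<in> A" for i
      proof (cases "i \<in> J")
        case True
        then have "f i = x i" using f by (auto simp: cyl_def)
        then show ?thesis using U(2) i by auto
      qed (use i in \<open>auto simp: J_def\<close>)
      then show "f \<in> Pi\<^sub>E A U" using f by (auto simp: cyl_def PiE_def)
    qed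
    ultimately show ?thesis using subset_trans[OF _ U(3)] by (intro bexI[of _ ?C] conjI)
  qed
  ultimately show "S \<subseteq> extensional A \<and> (\<forall>x\<in>S. \<exists>C\<in>cylinders A. x \<in> C \<and> C \<subseteq> S)"
    by (intro conjI ballI)
next
  assume S: "S \<subseteq> extensional A \<and> (\<forall>x\<in>S. \<exists>C\<in>cylinders A. x \<in> C \<and> C \<subseteq> S)"
  have "\<exists>U. finite {i \<in> A. U i \<noteq> topspace (discrete_topology (UNIV :: bool set))} \<and>
      (\<forall>i\<in>A. openin (discrete_topology UNIV) (U i)) \<and> x \<in> Pi\<^sub>E A U \<and> Pi\<^sub>E A U \<subseteq> S"
    if x: "x \<in> S" for x
  proof -
    obtain C where C: "C \<in> cylinders A" "x \<in> C" "C \<subseteq> S" using S x by blast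
    then obtain F P where FP: "F \<in> Fpow A" "P \<in> Fpow A" "x \<in> cyl A F P" "cyl A F P \<subseteq> S"
      unfolding cylinders_def by auto
    define U where "U i = {b. (i \<in> F \<longrightarrow> b) \<and> (i \<in> P \<longrightarrow> \<not> b)}" for i
    have "{i \<in> A. U i \<noteq> UNIV} \<subseteq> F \<union> P" by (auto simp: U_def)
    moreover have "finite (F \<union> P)" using FP(1,2) by (simp add: Fpow_def)
    ultimately have "finite {i \<in> A. U i \<noteq> UNIV}" by (rule finite_subset)
    moreover have "Pi\<^sub>E A U = cyl A F P"
      using FP(1,2) by (auto simp: cyl_def PiE_def U_def Fpow_def Pi_def)
    ultimately show ?thesis using FP(3,4) by (intro exI[of _ U]) simp
  qed
  then show "openin (cantor_space A) S"
    unfolding cantor_space_def openin_product_topology_alt by blast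
qed

lemma openin_cylinder: "C \<in> cylinders A \<Longrightarrow> openin (cantor_space A) C"
  unfolding openin_cantor_space by (auto simp: cylinders_def cyl_def)

lemma closedin_cylinder:
  assumes "C \<in> cylinders A"
  shows "closedin (cantor_space A) C"
  unfolding closedin_def topspace_cantor_space openin_cantor_space
proof (intro conjI ballI)
  obtain F P where FP: "F \<in> Fpow A" "P \<in> Fpow A" "C = cyl A F P"
    using assms unfolding cylinders_def by blast
  then show "C \<subseteq> extensional A" by (auto simp: cyl_def)
  fix x assume x: "x \<in> extensional A - C"
  then consider i where "i \<in> F" "\<not> x i" | i where "i \<in> P" "x i"
    using FP(3) by (auto simp: cyl_def)
  then show "\<exists>C'\<in>cylinders A. x \<in> C' \<and> C' \<subseteq> extensional A - C"
  proof cases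
    case (1 i)
    have "cyl A {} {i} \<in> cylinders A"
      using 1 FP(1) by (intro cyl_in_cylinders) (auto simp: Fpow_def)
    then show ?thesis
      using 1 x FP(3) by (intro bexI[of _ "cyl A {} {i}"]) (auto simp: cyl_def)
  next
    case (2 i)
    have "cyl A {i} {} \<in> cylinders A"
      using 2 FP(2) by (intro cyl_in_cylinders) (auto simp: Fpow_def)
    then show ?thesis
      using 2 x FP(3) by (intro bexI[of _ "cyl A {i} {}"]) (auto simp: cyl_def)
  qed
qed auto

text \<open>Since cylinders form a base, closures and interiors can be replaced by refining
  cylinders; nowhere density is proved in this form below.\<close>

lemma nowhere_dense_in_cantor_space:
  "nowhere_dense_in (cantor_space A) N \<longleftrightarrow> N \<subseteq> extensional A \<and>
     (\<forall>C\<in>cylinders A. C \<noteq> {} \<longrightarrow> (\<exists>C'\<in>cylinders A. C' \<noteq> {} \<and> C' \<subseteq> C \<and> C' \<inter> N = {}))"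
  (is "?L \<longleftrightarrow> ?R")
proof
  assume L: ?L
  then have sub: "N \<subseteq> extensional A"
    by (simp add: nowhere_dense_in_def topspace_cantor_space)
  have "\<exists>C'\<in>cylinders A. C' \<noteq> {} \<and> C' \<subseteq> C \<and> C' \<inter> N = {}"
    if C: "C \<in> cylinders A" "C \<noteq> {}" for C
  proof -
    let ?K = "cantor_space A closure_of N"
    have "\<not> C \<subseteq> ?K"
      using interior_of_maximal[OF _ openin_cylinder[OF C(1)], of ?K] C(2) L
      unfolding nowhere_dense_in_def by blast
    then obtain x where "x \<in> C - ?K" by blast
    moreover have "openin (cantor_space A) (C - ?K)"
      using openin_cylinder[OF C(1)] by (intro openin_diff) auto
    ultimately obtain C' where "C' \<in> cylinders A" "x \<in> C'" "C' \<subseteq> C - ?K"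
      unfolding openin_cantor_space by blast
    moreover have "N \<subseteq> ?K"
      using sub by (intro closure_of_subset) (simp add: topspace_cantor_space)
    ultimately show ?thesis by blast
  qed
  with sub show ?R by blast
next
  assume R: ?R
  have "cantor_space A interior_of (cantor_space A closure_of N) = {}"
  proof (rule ccontr)
    assume "cantor_space A interior_of (cantor_space A closure_of N) \<noteq> {}"
    then obtain x where "x \<in> cantor_space A interior_of (cantor_space A closure_of N)" by blast
    moreover have "openin (cantor_space A) (cantor_space A interior_of (cantor_space A closure_of N))"
      by simp
    ultimately obtain C where C: "C \<in> cylinders A" "x \<in> C"
        "C \<subseteq> cantor_space A interior_of (cantor_space A closure_of N)"
      unfolding openin_cantor_space by blast
    then obtain C' where C': "C' \<in> cylinders A" "C' \<noteq> {}" "C' \<subseteq> C" "C' \<inter> N = {}"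
      using R by blast
    then obtain y where y: "y \<in> C'" by blast
    have "C' \<subseteq> cantor_space A closure_of N"
      using C'(3) C(3) interior_of_subset by (metis subset_trans)
    then have "y \<in> cantor_space A closure_of N" using y by blast
    then show False
      using C'(4) y openin_cylinder[OF C'(1)] unfolding in_closure_of by blast
  qed
  then show ?L
    using R by (simp add: nowhere_dense_in_def topspace_cantor_space)
qed

lemma compact_space_cantor_space: "compact_space (cantor_space A)"
  by (simp add: cantor_space_def compact_space_product_topology compact_space_discrete_topology)

lemma clopen_finite_Union_cylinders:
  assumes "openin (cantor_space A) C" "closedin (cantor_space A) C"
  shows "\<exists>\<C>\<subseteq>cylinders A. finite \<C> \<and> C = \<Union>\<C>"
proof -
  have "compactin (cantor_space A) C"
    using assms(2) compact_space_cantor_space closedin_compact_space by blast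
  moreover have "C \<subseteq> \<Union>{B \<in> cylinders A. B \<subseteq> C}"
    using assms(1) unfolding openin_cantor_space by blast
  ultimately obtain \<C> where "finite \<C>" "\<C> \<subseteq> {B \<in> cylinders A. B \<subseteq> C}" "C \<subseteq> \<Union>\<C>"
    using openin_cylinder unfolding compactin_def by (metis (no_types, lifting) mem_Collect_eq)
  then show ?thesis by (intro exI[of _ \<C>]) auto
qed

text \<open>The Baire category theorem for a compact regular space, applied to the closures of the
  nowhere dense sets.\<close>

lemma cylinder_not_meagre:
  assumes "C \<in> cylinders A" "C \<noteq> {}" "meagre_in (cantor_space A) Y"
  shows "\<not> C \<subseteq> Y"
proof
  assume "C \<subseteq> Y"
  obtain \<N> where \<N>: "countable \<N>" "\<And>N. N \<in> \<N> \<Longrightarrow> nowhere_dense_in (cantor_space A) N" "Y = \<Union>\<N>"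
    using assms(3) unfolding meagre_in_def by blast
  let ?cl = "\<lambda>N. cantor_space A closure_of N"
  have "cantor_space A interior_of \<Union>(?cl ` \<N>) = {}"
  proof (rule Baire_category_alt)
    have "regular_space (cantor_space A)"
      by (simp add: cantor_space_def regular_space_product_topology regular_space_discrete_topology)
    then show "completely_metrizable_space (cantor_space A) \<or>
        locally_compact_space (cantor_space A) \<and> regular_space (cantor_space A)"
      using compact_imp_locally_compact_space compact_space_cantor_space by blast
  qed (use \<N>(1,2) in \<open>auto simp: nowhere_dense_in_def\<close>)
  moreover have "Y \<subseteq> \<Union>(?cl ` \<N>)"
    using \<N>(2,3) closure_of_subset unfolding nowhere_dense_in_def by fastforce
  ultimately show False
    using interior_of_maximal[OF _ openin_cylinder[OF assms(1)], of "\<Union>(?cl ` \<N>)"] \<open>C \<subseteq> Y\<close> assms(2)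
    by blast
qed

section \<open>Transfer along injections of the index sets\<close>

text \<open>For injective \<open>\<Delta>\<close> this is a right inverse of composition with
  \<open>\<Delta>\<close>, keeping \<open>f\<close> off the range. It lifts points back without
  leaving a given cylinder.\<close>

definition graft :: "('b \<Rightarrow> 'a) \<Rightarrow> ('b \<Rightarrow> bool) \<Rightarrow> ('a \<Rightarrow> bool) \<Rightarrow> 'a \<Rightarrow> bool" where
  "graft \<Delta> g f x = (if x \<in> range \<Delta> then g (inv \<Delta> x) else f x)"

lemma graft_comp: "inj \<Delta> \<Longrightarrow> graft \<Delta> g f \<circ> \<Delta> = g"
  by (auto simp: graft_def)

lemma graft_in_cyl:
  assumes "inj \<Delta>" "range \<Delta> \<subseteq> A" "f \<in> cyl A F P" "g \<in> cyl UNIV (\<Delta> -` F) (\<Delta> -` P)"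
  shows "graft \<Delta> g f \<in> cyl A F P"
  using assms by (auto simp: cyl_def graft_def extensional_def)

text \<open>A cylinder is restricted to the coordinates visible through \<open>e\<close>, shrunk
  there to avoid \<open>N\<close>, and the new constraints are carried back along \<open>e\<close>.
  Grafting shows that old and new constraints are jointly satisfiable.\<close>

lemma nowhere_dense_in_comp_vimage:
  fixes e :: "nat \<Rightarrow> nat"
  assumes e: "inj e" and N: "nowhere_dense_in (cantor_space UNIV) N"
  shows "nowhere_dense_in (cantor_space UNIV) {g. g \<circ> e \<in> N}"
  unfolding nowhere_dense_in_cantor_space
proof (intro conjI ballI impI)
  fix C assume "C \<in> cylinders (UNIV :: nat set)" "C \<noteq> {}"
  then obtain F P f where FP: "finite F" "finite P" "C = cyl UNIV F P" "f \<in> C"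
    by (auto simp: cylinders_def Fpow_def)
  have "f \<circ> e \<in> cyl UNIV (e -` F) (e -` P)" using FP(3,4) by (auto simp: cyl_def)
  moreover have "cyl UNIV (e -` F) (e -` P) \<in> cylinders UNIV"
    using FP(1,2) e by (intro cyl_in_cylinders) (auto simp: Fpow_def finite_vimageI)
  ultimately obtain C' where C': "C' \<in> cylinders UNIV" "C' \<noteq> {}"
      "C' \<subseteq> cyl UNIV (e -` F) (e -` P)" "C' \<inter> N = {}"
    using N unfolding nowhere_dense_in_cantor_space by (metis empty_iff)
  then obtain F' P' h where FP': "finite F'" "finite P'" "C' = cyl UNIV F' P'" "h \<in> C'"
    by (auto simp: cylinders_def Fpow_def)
  let ?C = "cyl UNIV (F \<union> e ` F') (P \<union> e ` P')"
  have "?C \<in> cylinders UNIV"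
    using FP(1,2) FP'(1,2) by (intro cyl_in_cylinders) (auto simp: Fpow_def)
  moreover have "graft e h f \<in> cyl UNIV F P"
    by (rule graft_in_cyl[OF e]) (use FP C'(3) FP'(4) in auto)
  then have "graft e h f \<in> ?C"
    using FP'(3,4) graft_comp[OF e, of h f] by (auto simp: cyl_def fun_eq_iff)
  then have "?C \<noteq> {}" by blast
  moreover have "?C \<subseteq> C" using FP(3) by (auto simp: cyl_def)
  moreover have "?C \<inter> {g. g \<circ> e \<in> N} = {}"
  proof -
    have "g \<circ> e \<in> C'" if "g \<in> ?C" for g
      using that FP'(3) by (auto simp: cyl_def)
    then show ?thesis using C'(4) by blast
  qed
  ultimately show "\<exists>C'\<in>cylinders UNIV. C' \<noteq> {} \<and> C' \<subseteq> C \<and> C' \<inter> {g. g \<circ> e \<in> N} = {}"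
    by blast
qed simp

lemma meagre_in_comp_vimage:
  fixes e :: "nat \<Rightarrow> nat"
  assumes e: "inj e" and Y: "meagre_in (cantor_space UNIV) Y"
  shows "meagre_in (cantor_space UNIV) {g. g \<circ> e \<in> Y}"
proof -
  obtain \<N> where \<N>: "countable \<N>" "\<forall>N\<in>\<N>. nowhere_dense_in (cantor_space UNIV) N" "Y = \<Union>\<N>"
    using Y unfolding meagre_in_def by blast
  show ?thesis
    unfolding meagre_in_def
    by (rule exI[of _ "(\<lambda>N. {g. g \<circ> e \<in> N}) ` \<N>"])
      (use \<N> nowhere_dense_in_comp_vimage[OF e] in auto)
qed

lemma meagre_in_UN:
  assumes "\<And>n :: nat. meagre_in T (Y n)"
  shows "meagre_in T (\<Union>n. Y n)"
proof -
  have "\<forall>n. \<exists>\<N>. countable \<N> \<and> (\<forall>N\<in>\<N>. nowhere_dense_in T N) \<and> Y n = \<Union>\<N>"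
    by (rule allI) (rule assms[unfolded meagre_in_def])
  from choice[OF this] obtain \<N> where
    \<N>: "\<forall>n. countable (\<N> n) \<and> (\<forall>N\<in>\<N> n. nowhere_dense_in T N) \<and> Y n = \<Union>(\<N> n)" ..
  have "(\<Union>n. Y n) = \<Union>(\<Union>n. \<N> n)" using \<N> by auto
  moreover have "countable (\<Union>n. \<N> n)" using \<N> by simp
  moreover have "\<forall>N\<in>(\<Union>n. \<N> n). nowhere_dense_in T N" using \<N> by simp
  ultimately show ?thesis
    unfolding meagre_in_def by (intro exI[of _ "\<Union>n. \<N> n"] conjI)
qed

text \<open>\<open>S\<close> may be finite, so a countably infinite subset of \<open>A\<close> is
  added before enumerating injectively.\<close>

lemma ex_enumeration_superset:
  assumes "infinite A" "countable S" "S \<subseteq> A"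
  shows "\<exists>\<Delta> :: nat \<Rightarrow> 'a. inj \<Delta> \<and> range \<Delta> \<subseteq> A \<and> S \<subseteq> range \<Delta>"
proof -
  obtain S' where S': "S' \<subseteq> A" "countable S'" "infinite S'"
    using assms(1) infinite_countable_subset' by metis
  have "bij_betw (from_nat_into (S \<union> S')) UNIV (S \<union> S')"
    by (rule bij_betw_from_nat_into) (use assms(2) S' in auto)
  then show ?thesis
    using assms(3) S'(1) unfolding bij_betw_def
    by (intro exI[of _ "from_nat_into (S \<union> S')"]) auto
qed

lemma meagre_idealI:
  fixes \<Delta> :: "nat \<Rightarrow> 'a"
  assumes "X \<subseteq> extensional A" "inj \<Delta>" "range \<Delta> \<subseteq> A" "meagre_in (cantor_space UNIV) Y"
    "\<And>f. f \<in> X \<Longrightarrow> f \<circ> \<Delta> \<in> Y"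
  shows "X \<in> meagre_ideal A"
  unfolding meagre_ideal_def mem_Collect_eq topspace_cantor_space
  by (intro conjI exI[of _ \<Delta>] exI[of _ Y] ballI assms)

lemma meagre_idealE:
  assumes "X \<in> meagre_ideal A"
  obtains \<Delta> :: "nat \<Rightarrow> 'a" and Y where "X \<subseteq> extensional A" "inj \<Delta>" "range \<Delta> \<subseteq> A"
    "meagre_in (cantor_space UNIV) Y" "\<And>f. f \<in> X \<Longrightarrow> f \<circ> \<Delta> \<in> Y"
  using assms unfolding meagre_ideal_def mem_Collect_eq topspace_cantor_space
  by (elim conjE exE) (rule that, assumption+, erule bspec, assumption)

text \<open>All the witnessing injections factor through one injection \<open>\<Gamma>\<close> whose
  range contains theirs, and the meagre sets are pulled back along the factors.\<close>

lemma meagre_ideal_UN: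
  fixes A :: "'a set"
  assumes A: "infinite A" and X: "\<And>n :: nat. X n \<in> meagre_ideal A"
  shows "(\<Union>n. X n) \<in> meagre_ideal A"
proof -
  have "\<forall>n. \<exists>\<Delta> Y. inj \<Delta> \<and> range \<Delta> \<subseteq> A \<and> meagre_in (cantor_space (UNIV :: nat set)) Y \<and>
      (\<forall>f\<in>X n. f \<circ> \<Delta> \<in> Y)"
  proof
    fix n
    from X[of n] show "\<exists>\<Delta> Y. inj \<Delta> \<and> range \<Delta> \<subseteq> A \<and>
        meagre_in (cantor_space (UNIV :: nat set)) Y \<and> (\<forall>f\<in>X n. f \<circ> \<Delta> \<in> Y)"
      unfolding meagre_ideal_def mem_Collect_eq by (rule conjunct2)
  qed
  from choice[OF this] obtain \<Delta> where "\<forall>n. \<exists>Y. inj (\<Delta> n) \<and> range (\<Delta> n) \<subseteq> A \<and>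
      meagre_in (cantor_space (UNIV :: nat set)) Y \<and> (\<forall>f\<in>X n. f \<circ> \<Delta> n \<in> Y)" ..
  from choice[OF this] obtain Y where "\<forall>n. inj (\<Delta> n) \<and> range (\<Delta> n) \<subseteq> A \<and>
      meagre_in (cantor_space (UNIV :: nat set)) (Y n) \<and> (\<forall>f\<in>X n. f \<circ> \<Delta> n \<in> Y n)" ..
  then have \<Delta>: "inj (\<Delta> n)" "range (\<Delta> n) \<subseteq> A" "meagre_in (cantor_space UNIV) (Y n)"
      "f \<in> X n \<Longrightarrow> f \<circ> \<Delta> n \<in> Y n" for n f
    by simp_all
  have "countable (\<Union>n. range (\<Delta> n))" "(\<Union>n. range (\<Delta> n)) \<subseteq> A"
    using \<Delta>(2) by auto
  then obtain \<Gamma> :: "nat \<Rightarrow> 'a" where \<Gamma>: "inj \<Gamma>" "range \<Gamma> \<subseteq> A" "(\<Union>n. range (\<Delta> n)) \<subseteq> range \<Gamma>"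
    using ex_enumeration_superset[OF A] by metis
  define e where "e n = inv \<Gamma> \<circ> \<Delta> n" for n
  have e: "\<Gamma> \<circ> e n = \<Delta> n" for n
  proof
    fix k
    have "\<Delta> n k \<in> range \<Gamma>" using \<Gamma>(3) by blast
    then show "(\<Gamma> \<circ> e n) k = \<Delta> n k" by (simp add: e_def f_inv_into_f)
  qed
  then have inj: "inj (e n)" for n
    using \<Delta>(1) by (metis inj_on_imageI2)
  have "f \<circ> \<Gamma> \<circ> e n \<in> Y n" if "f \<in> X n" for f n
    using \<Delta>(4)[OF that] e[of n] by (simp add: comp_assoc)
  then have "f \<circ> \<Gamma> \<in> (\<Union>n. {g. g \<circ> e n \<in> Y n})" if f: "f \<in> (\<Union>n. X n)" for f
    using f by auto
  moreover have "meagre_in (cantor_space UNIV) (\<Union>n. {g. g \<circ> e n \<in> Y n})"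
    by (intro meagre_in_UN meagre_in_comp_vimage inj \<Delta>(3))
  moreover have "(\<Union>n. X n) \<subseteq> extensional A"
    using X by (auto simp: meagre_ideal_def topspace_cantor_space)
  ultimately show ?thesis
    using \<Gamma>(1,2) by (intro meagre_idealI[of _ A \<Gamma>])
qed

text \<open>By grafting, composition with \<open>\<Delta>\<close> maps a nonempty cylinder onto a
  set containing a nonempty cylinder over the naturals, which is not meagre.\<close>

lemma cylinder_notin_meagre_ideal:
  assumes C: "C \<in> cylinders A" "C \<noteq> {}"
  shows "C \<notin> meagre_ideal A"
proof
  assume "C \<in> meagre_ideal A"
  then obtain \<Delta> :: "nat \<Rightarrow> 'a" and Y where \<Delta>: "inj \<Delta>" "range \<Delta> \<subseteq> A"
      "meagre_in (cantor_space UNIV) Y" "\<And>f. f \<in> C \<Longrightarrow> f \<circ> \<Delta> \<in> Y"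
    by (rule meagre_idealE) (rule that)
  obtain F P f where FP: "finite F" "finite P" "C = cyl A F P" "f \<in> C"
    using C by (auto simp: cylinders_def Fpow_def)
  have "cyl UNIV (\<Delta> -` F) (\<Delta> -` P) \<in> cylinders UNIV"
    using FP(1,2) \<Delta>(1) by (intro cyl_in_cylinders) (auto simp: Fpow_def finite_vimageI)
  moreover have "f \<circ> \<Delta> \<in> cyl UNIV (\<Delta> -` F) (\<Delta> -` P)"
    using FP(3,4) by (auto simp: cyl_def)
  moreover have "cyl UNIV (\<Delta> -` F) (\<Delta> -` P) \<subseteq> Y"
  proof
    fix g assume "g \<in> cyl UNIV (\<Delta> -` F) (\<Delta> -` P)"
    then have "graft \<Delta> g f \<in> C"
      using graft_in_cyl[OF \<Delta>(1,2)] FP(3,4) by blast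
    then show "g \<in> Y" using \<Delta>(4) graft_comp[OF \<Delta>(1)] by metis
  qed
  ultimately show False
    using cylinder_not_meagre[OF _ _ \<Delta>(3)] by blast
qed

lemma proper_sigma_ideal_meagre:
  assumes A: "infinite A"
  shows "proper_sigma_ideal (extensional A) (baire_algebra A) (meagre_ideal A)"
proof -
  have "sigma_algebra (extensional A) (baire_algebra A)"
    unfolding baire_algebra_def topspace_cantor_space
    using openin_subset topspace_cantor_space by (intro sigma_algebra_sigma_sets) blast
  moreover have "proper_sigma_ideal_axioms (extensional A) (meagre_ideal A)"
  proof
    obtain \<Delta> :: "nat \<Rightarrow> 'a" where "inj \<Delta>" "range \<Delta> \<subseteq> A"
      using ex_enumeration_superset[OF A, of "{}"] by (metis countable_empty empty_subsetI)
    moreover have "meagre_in (cantor_space UNIV) ({} :: (nat \<Rightarrow> bool) set)"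
      unfolding meagre_in_def by (intro exI[of _ "{}"]) auto
    ultimately show "{} \<in> meagre_ideal A" by (intro meagre_idealI) auto
    show "Y \<in> meagre_ideal A" if X: "X \<in> meagre_ideal A" and Y: "Y \<subseteq> X" for X Y
      using X
    proof (rule meagre_idealE)
      fix \<Delta> :: "nat \<Rightarrow> 'a" and Z
      assume "X \<subseteq> extensional A" "inj \<Delta>" "range \<Delta> \<subseteq> A" "meagre_in (cantor_space UNIV) Z"
        "\<And>f. f \<in> X \<Longrightarrow> f \<circ> \<Delta> \<in> Z"
      then show ?thesis
        using Y by (intro meagre_idealI[of Y A \<Delta> Z]) auto
    qed
    show "(\<Union>n. X n) \<in> meagre_ideal A" if "\<And>n :: nat. X n \<in> meagre_ideal A" for X
      using that by (rule meagre_ideal_UN[OF A])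
    \<comment> \<open>Properness is the case of the cylinder without constraints.\<close>
    have "cyl A {} {} = extensional A" by (auto simp: cyl_def)
    then show "extensional A \<notin> meagre_ideal A"
      using cylinder_notin_meagre_ideal[of "cyl A {} {}" A] cyl_in_cylinders[of "{}" A "{}"]
      by (auto simp: Fpow_def extensional_def)
  qed
  ultimately show ?thesis by (simp add: proper_sigma_ideal_def)
qed

section \<open>The Baire property via countable unions of cylinders\<close>

lemma cylinder_in_baire_algebra: "C \<in> cylinders A \<Longrightarrow> C \<in> baire_algebra A"
  unfolding baire_algebra_def
  using openin_cylinder closedin_cylinder by (intro sigma_sets.Basic) blast

text \<open>
  The cylinders in \<open>\<C>\<close> are supported in a countable set; in that many coordinates there are only
  countably many cylinders, and those disjoint from \<open>\<Union>\<C>\<close> fill its complement up to its boundary.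
\<close>

lemma cylinders_complement_mod_meagre:
  fixes A :: "'a set"
  assumes A: "infinite A" and \<C>: "\<C> \<subseteq> cylinders A" "countable \<C>"
  shows "\<exists>\<H>\<subseteq>cylinders A. countable \<H> \<and> \<Union>\<H> \<inter> \<Union>\<C> = {} \<and>
           extensional A - \<Union>\<C> - \<Union>\<H> \<in> meagre_ideal A"
proof -
  have "\<forall>C\<in>\<C>. \<exists>F P. F \<in> Fpow A \<and> P \<in> Fpow A \<and> C = cyl A F P"
    using \<C>(1) unfolding cylinders_def by blast
  then obtain F P where FP: "\<And>C. C \<in> \<C> \<Longrightarrow> F C \<in> Fpow A" "\<And>C. C \<in> \<C> \<Longrightarrow> P C \<in> Fpow A"
      "\<And>C. C \<in> \<C> \<Longrightarrow> C = cyl A (F C) (P C)"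
    by metis
  let ?S = "\<Union>C\<in>\<C>. F C \<union> P C"
  have "countable ?S"
    using FP(1,2) \<C>(2) by (intro countable_UN countable_Un) (auto simp: Fpow_def countable_finite)
  moreover have "?S \<subseteq> A" using FP(1,2) by (auto simp: Fpow_def)
  ultimately obtain \<Delta> :: "nat \<Rightarrow> 'a" where \<Delta>: "inj \<Delta>" "range \<Delta> \<subseteq> A" "?S \<subseteq> range \<Delta>"
    using ex_enumeration_superset[OF A] by metis
  define \<H> where "\<H> = {H \<in> (\<lambda>(F, P). cyl A (\<Delta> ` F) (\<Delta> ` P)) ` (Collect finite \<times> Collect finite).
      H \<inter> \<Union>\<C> = {}}"
  have mem\<H>: "cyl A (\<Delta> ` F) (\<Delta> ` P) \<in> \<H>"
    if "finite F" "finite P" "cyl A (\<Delta> ` F) (\<Delta> ` P) \<inter> \<Union>\<C> = {}" for F P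
    using that by (auto simp: \<H>_def)
  have "\<H> \<subseteq> cylinders A"
  proof
    fix H assume "H \<in> \<H>"
    then obtain F P where "finite F" "finite P" "H = cyl A (\<Delta> ` F) (\<Delta> ` P)"
      by (auto simp: \<H>_def)
    moreover have "\<Delta> ` F \<subseteq> A" "\<Delta> ` P \<subseteq> A" using \<Delta>(2) by blast+
    ultimately show "H \<in> cylinders A" by (simp add: Fpow_def cyl_in_cylinders)
  qed
  moreover have "countable \<H>"
  proof -
    have "countable ((\<lambda>(F, P). cyl A (\<Delta> ` F) (\<Delta> ` P)) ` (Collect finite \<times> Collect finite))"
      by (intro countable_image countable_SIGMA countable_Collect_finite)
    then show ?thesis
      by (rule countable_subset[rotated]) (auto simp: \<H>_def)
  qed
  moreover have "\<Union>\<H> \<inter> \<Union>\<C> = {}" by (auto simp: \<H>_def)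
  moreover have "extensional A - \<Union>\<C> - \<Union>\<H> \<in> meagre_ideal A"
  proof -
    let ?X = "extensional A - \<Union>\<C> - \<Union>\<H>"
    let ?Y = "(\<lambda>f. f \<circ> \<Delta>) ` ?X"
    have "nowhere_dense_in (cantor_space UNIV) ?Y"
      unfolding nowhere_dense_in_cantor_space
    proof (intro conjI ballI impI)
      fix B assume "B \<in> cylinders (UNIV :: nat set)" "B \<noteq> {}"
      then obtain F0 P0 g where B: "finite F0" "finite P0" "B = cyl UNIV F0 P0" "g \<in> B"
        by (auto simp: cylinders_def Fpow_def)
      let ?B = "cyl A (\<Delta> ` F0) (\<Delta> ` P0)"
      have pull: "f \<in> ?B" if "f \<circ> \<Delta> \<in> B" "f \<in> extensional A" for f
        using that B(3) by (auto simp: cyl_def)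
      show "\<exists>B'\<in>cylinders UNIV. B' \<noteq> {} \<and> B' \<subseteq> B \<and> B' \<inter> ?Y = {}"
      \<comment> \<open>If the lift \<open>?B\<close> misses the union it is one of the sets in
        \<open>\<H>\<close>, so \<open>B\<close> already avoids \<open>?Y\<close>. Otherwise
        \<open>B\<close> is refined by the constraints of some \<open>C\<close> that
        \<open>?B\<close> meets.\<close>
      proof (cases "?B \<inter> \<Union>\<C> = {}")
        case True
        then have "?B \<in> \<H>" using mem\<H> B by blast
        then have "B \<inter> ?Y = {}" using pull by blast
        then show ?thesis
          using \<open>B \<in> cylinders UNIV\<close> \<open>B \<noteq> {}\<close> by blast
      next
        case False
        then obtain C f where C: "C \<in> \<C>" "f \<in> C" "f \<in> ?B" by blast
        let ?B' = "cyl UNIV (F0 \<union> \<Delta> -` F C) (P0 \<union> \<Delta> -` P C)"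
        have "?B' \<in> cylinders UNIV"
          using B(1,2) FP(1,2)[OF C(1)] \<Delta>(1)
          by (intro cyl_in_cylinders) (auto simp: Fpow_def finite_vimageI)
        moreover have "f \<circ> \<Delta> \<in> ?B'"
          using C FP(3)[OF C(1)] by (auto simp: cyl_def)
        moreover have "?B' \<subseteq> B" using B(3) by (auto simp: cyl_def)
        \<comment> \<open>All constraints of \<open>C\<close> lie in the range of
          \<open>\<Delta>\<close>, so \<open>h \<circ> \<Delta>\<close> decides membership of
          \<open>h\<close> in \<open>C\<close>.\<close>
        moreover have "h \<in> C" if h: "h \<in> extensional A" "h \<circ> \<Delta> \<in> ?B'" for h
        proof -
          have "h i" if i: "i \<in> F C" for i
          proof -
            have "i \<in> range \<Delta>" using \<Delta>(3) C(1) i by blast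
            then show ?thesis using h(2) i by (auto simp: cyl_def)
          qed
          moreover have "\<not> h i" if i: "i \<in> P C" for i
          proof -
            have "i \<in> range \<Delta>" using \<Delta>(3) C(1) i by blast
            then show ?thesis using h(2) i by (auto simp: cyl_def)
          qed
          ultimately have "h \<in> cyl A (F C) (P C)" using h(1) by (auto simp: cyl_def)
          then show ?thesis using FP(3)[OF C(1)] by simp
        qed
        then have "?B' \<inter> ?Y = {}" using C(1) by blast
        ultimately show ?thesis by blast
      qed
    qed simp
    then have "meagre_in (cantor_space UNIV) ?Y"
      unfolding meagre_in_def by (intro exI[of _ "{?Y}"]) auto
    then show ?thesis
      using \<Delta>(1,2) by (intro meagre_idealI[of ?X A \<Delta> ?Y]) auto
  qed
  ultimately show ?thesis by blast
qed

text \<open>Induction over the generation of the algebra. Clopen sets are finite unions of cylinders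
  by compactness, and complements are handled by the preceding lemma.\<close>

lemma baire_algebra_mod_meagre:
  assumes A: "infinite A" and X: "X \<in> baire_algebra A"
  shows "\<exists>\<C>\<subseteq>cylinders A. countable \<C> \<and> X - \<Union>\<C> \<in> meagre_ideal A \<and> \<Union>\<C> - X \<in> meagre_ideal A"
proof -
  interpret proper_sigma_ideal "extensional A" "baire_algebra A" "meagre_ideal A"
    by (rule proper_sigma_ideal_meagre[OF A])
  show ?thesis
    using X unfolding baire_algebra_def
  proof (induction rule: sigma_sets.induct)
    case (Basic C)
    then obtain \<C> where "\<C> \<subseteq> cylinders A" "finite \<C>" "C = \<Union>\<C>"
      using clopen_finite_Union_cylinders by blast
    then show ?case
      using ideal_empty by (intro exI[of _ \<C>]) (auto simp: countable_finite)
  next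
    case Empty
    then show ?case using ideal_empty by (intro exI[of _ "{}"]) auto
  next
    case (Compl X)
    then obtain \<C> where \<C>: "\<C> \<subseteq> cylinders A" "countable \<C>"
        "X - \<Union>\<C> \<in> meagre_ideal A" "\<Union>\<C> - X \<in> meagre_ideal A" by blast
    obtain \<H> where \<H>: "\<H> \<subseteq> cylinders A" "countable \<H>" "\<Union>\<H> \<inter> \<Union>\<C> = {}"
        "extensional A - \<Union>\<C> - \<Union>\<H> \<in> meagre_ideal A"
      using cylinders_complement_mod_meagre[OF A \<C>(1,2)] by (elim exE conjE) (rule that)
    have "(topspace (cantor_space A) - X) - \<Union>\<H> \<in> meagre_ideal A"
      by (rule ideal_subset[OF ideal_Un[OF \<H>(4) \<C>(4)]]) (auto simp: topspace_cantor_space)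
    moreover have "\<Union>\<H> \<subseteq> extensional A"
      using \<H>(1) by (force simp: cylinders_def cyl_def)
    then have "\<Union>\<H> - (topspace (cantor_space A) - X) \<in> meagre_ideal A"
      by (intro ideal_subset[OF \<C>(3)]) (use \<H>(3) in \<open>auto simp: topspace_cantor_space\<close>)
    ultimately show ?case using \<H>(1,2) by blast
  next
    case (Union X)
    then have "\<forall>n. \<exists>\<C>\<subseteq>cylinders A. countable \<C> \<and> X n - \<Union>\<C> \<in> meagre_ideal A \<and>
        \<Union>\<C> - X n \<in> meagre_ideal A" by (intro allI)
    from choice[OF this] obtain \<C> where "\<forall>n. \<C> n \<subseteq> cylinders A \<and> countable (\<C> n) \<and>
        X n - \<Union>(\<C> n) \<in> meagre_ideal A \<and> \<Union>(\<C> n) - X n \<in> meagre_ideal A" ..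
    then have \<C>: "\<C> n \<subseteq> cylinders A" "countable (\<C> n)"
        "X n - \<Union>(\<C> n) \<in> meagre_ideal A" "\<Union>(\<C> n) - X n \<in> meagre_ideal A" for n
      by simp_all
    have "(\<Union>n. X n) - \<Union>(\<Union>n. \<C> n) \<in> meagre_ideal A"
      by (rule ideal_subset[OF ideal_UN_nat[of "\<lambda>n. X n - \<Union>(\<C> n)", OF \<C>(3)]]) blast
    moreover have "\<Union>(\<Union>n. \<C> n) - (\<Union>n. X n) \<in> meagre_ideal A"
      by (rule ideal_subset[OF ideal_UN_nat[of "\<lambda>n. \<Union>(\<C> n) - X n", OF \<C>(4)]]) blast
    ultimately show ?case
      using \<C>(1,2) by (intro exI[of _ "\<Union>n. \<C> n"]) auto
  qed
qed

lemma baire_algebra_mod_meagre_sequence: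
  assumes A: "infinite A" and X: "X \<in> baire_algebra A"
  shows "\<exists>d. range d \<subseteq> cylinders A \<and> X - (\<Union>n :: nat. d n) \<in> meagre_ideal A \<and>
           (\<Union>n. d n) - X \<in> meagre_ideal A"
proof -
  obtain \<C> where \<C>: "\<C> \<subseteq> cylinders A" "countable \<C>"
      "X - \<Union>\<C> \<in> meagre_ideal A" "\<Union>\<C> - X \<in> meagre_ideal A"
    using baire_algebra_mod_meagre[OF assms] by blast
  \<comment> \<open>Inserting the empty cylinder leaves the union unchanged and makes the enumerated
    set nonempty.\<close>
  let ?d = "from_nat_into (insert {} \<C>)"
  have "range ?d = insert {} \<C>" using \<C>(2) by (intro range_from_nat_into) auto
  moreover from this have "(\<Union>n. ?d n) = \<Union>\<C>" by simp
  moreover have "A \<noteq> {}" using A by auto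
  ultimately show ?thesis
    using \<C> empty_in_cylinders[of A] by (intro exI[of _ ?d]) auto
qed

section \<open>Counting cylinders and classes\<close>

lemma card_of_cylinders_le:
  assumes "infinite A"
  shows "|cylinders A| \<le>o |A|"
proof -
  have "|Fpow A \<times> Fpow A| \<le>o |A|"
    using card_of_Fpow_le[OF assms] assms
    by (intro card_of_Times_ordLeq_infinite_Field) (auto simp: Field_card_of card_of_card_order_on)
  then show ?thesis
    unfolding cylinders_def using card_of_image ordLeq_transitive by blast
qed

text \<open>Unions over sets of naturals of a countable disjoint family of nonempty cylinders, none
  of which is in the ideal.\<close>

lemma continuum_many_inequivalent:
  assumes A: "infinite A"
  shows "\<exists>E :: nat set \<Rightarrow> ('a \<Rightarrow> bool) set. (\<forall>S. E S \<in> baire_algebra A) \<and>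
    (\<forall>S T. E S - E T \<in> meagre_ideal A \<longrightarrow> S \<subseteq> T)"
proof -
  interpret proper_sigma_ideal "extensional A" "baire_algebra A" "meagre_ideal A"
    by (rule proper_sigma_ideal_meagre[OF A])
  obtain \<Delta> :: "nat \<Rightarrow> 'a" where \<Delta>: "inj \<Delta>" "range \<Delta> \<subseteq> A"
    using ex_enumeration_superset[OF A, of "{}"] by (metis countable_empty empty_subsetI)
  have mem: "\<Delta> n \<in> A" for n using \<Delta>(2) by blast
  \<comment> \<open>The points whose first \<open>True\<close> along \<open>\<Delta>\<close> occurs
    at position \<open>n\<close>; hence the sets are disjoint.\<close>
  define c where "c n = cyl A {\<Delta> n} (\<Delta> ` {..<n})" for n
  have c: "c n \<in> cylinders A" for n
    unfolding c_def using \<Delta>(2) by (intro cyl_in_cylinders) (auto simp: Fpow_def)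
  have ne: "c n \<noteq> {}" for n
  proof -
    have "restrict (\<lambda>x. x = \<Delta> n) A \<in> c n"
      using mem by (auto simp: c_def cyl_def dest: injD[OF \<Delta>(1)])
    then show ?thesis by blast
  qed
  have "c m \<inter> c n = {}" if "m < n" for m n
    using that by (auto simp: c_def cyl_def)
  then have disj: "c m \<inter> c n = {}" if "m \<noteq> n" for m n
    using that by (metis Int_commute linorder_neqE_nat)
  have "S \<subseteq> T" if sub: "(\<Union>n\<in>S. c n) - (\<Union>n\<in>T. c n) \<in> meagre_ideal A" for S T
  proof (rule ccontr)
    assume "\<not> S \<subseteq> T"
    then obtain n where n: "n \<in> S" "n \<notin> T" by blast
    have "c n \<inter> c m = {}" if "m \<in> T" for m
      using n(2) that by (intro disj) auto
    then have "c n \<subseteq> (\<Union>n\<in>S. c n) - (\<Union>n\<in>T. c n)" using n(1) by auto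
    then have "c n \<in> meagre_ideal A" using ideal_subset[OF sub] by simp
    then show False using cylinder_notin_meagre_ideal[OF c ne] by simp
  qed
  moreover have "(\<Union>n\<in>S. c n) \<in> baire_algebra A" for S
    using c cylinder_in_baire_algebra by (intro countable_UN') auto
  ultimately show ?thesis by (intro exI[of _ "\<lambda>S. \<Union>n\<in>S. c n"]) blast
qed

section \<open>Ultrafilters on the Cohen algebra\<close>

locale infinite_index =
  fixes A :: "'a set"
  assumes infinite_index: "infinite A"

sublocale infinite_index \<subseteq> proper_sigma_ideal "extensional A" "baire_algebra A" "meagre_ideal A"
  by (rule proper_sigma_ideal_meagre[OF infinite_index])

context infinite_index
begin

abbreviation cls :: "('a \<Rightarrow> bool) set \<Rightarrow> ('a \<Rightarrow> bool) set set" where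
  "cls X \<equiv> meagre_equiv A `` {X}"

section \<open>Order and lattice operations of the quotient\<close>

lemma meagre_equiv_iff:
  "(X, Y) \<in> meagre_equiv A \<longleftrightarrow> X \<in> baire_algebra A \<and> Y \<in> baire_algebra A \<and>
     X - Y \<in> meagre_ideal A \<and> Y - X \<in> meagre_ideal A"
proof -
  have "(X - Y) \<union> (Y - X) \<in> meagre_ideal A \<longleftrightarrow> X - Y \<in> meagre_ideal A \<and> Y - X \<in> meagre_ideal A"
    using ideal_Un ideal_subset by (metis Un_upper1 Un_upper2)
  then show ?thesis by (simp add: meagre_equiv_def)
qed

lemma ideal_Diff_trans:
  assumes "X - Y \<in> meagre_ideal A" "Y - Z \<in> meagre_ideal A"
  shows "X - Z \<in> meagre_ideal A"
  by (rule ideal_subset[OF ideal_Un[OF assms]]) blast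

lemma equiv_meagre_equiv: "equiv (baire_algebra A) (meagre_equiv A)"
proof (rule equivI)
  show "meagre_equiv A \<subseteq> baire_algebra A \<times> baire_algebra A"
    by (auto simp: meagre_equiv_iff)
  show "refl_on (baire_algebra A) (meagre_equiv A)"
    using ideal_empty by (auto simp: refl_on_def meagre_equiv_iff)
  show "sym (meagre_equiv A)"
    by (auto simp: sym_def meagre_equiv_iff)
  show "trans (meagre_equiv A)"
    unfolding trans_def meagre_equiv_iff using ideal_Diff_trans by blast
qed

lemma carrier_cohen_algebra: "carrier (cohen_algebra A) = cls ` baire_algebra A"
  by (auto simp: cohen_algebra_def quotient_def)

text \<open>The order is defined by existence of representatives; transitivity modulo the ideal
  makes the choice irrelevant.\<close>

lemma le_cls:
  assumes "X \<in> baire_algebra A" "Y \<in> baire_algebra A"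
  shows "cls X \<sqsubseteq>\<^bsub>cohen_algebra A\<^esub> cls Y \<longleftrightarrow> X - Y \<in> meagre_ideal A"
proof -
  have "cls X \<sqsubseteq>\<^bsub>cohen_algebra A\<^esub> cls Y \<longleftrightarrow>
      (\<exists>X'\<in>cls X. \<exists>Y'\<in>cls Y. X' - Y' \<in> meagre_ideal A)"
    by (simp add: cohen_algebra_def)
  also have "\<dots> \<longleftrightarrow> X - Y \<in> meagre_ideal A"
  proof
    assume "\<exists>X'\<in>cls X. \<exists>Y'\<in>cls Y. X' - Y' \<in> meagre_ideal A"
    then obtain X' Y' where XY: "X - X' \<in> meagre_ideal A" "X' - Y' \<in> meagre_ideal A"
        "Y' - Y \<in> meagre_ideal A"
      by (auto simp: meagre_equiv_iff)
    show "X - Y \<in> meagre_ideal A"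
      by (rule ideal_Diff_trans[OF ideal_Diff_trans[OF XY(1,2)] XY(3)])
  next
    assume "X - Y \<in> meagre_ideal A"
    moreover have "X \<in> cls X" "Y \<in> cls Y"
      using assms ideal_empty by (auto simp: meagre_equiv_iff)
    ultimately show "\<exists>X'\<in>cls X. \<exists>Y'\<in>cls Y. X' - Y' \<in> meagre_ideal A" by (intro bexI)
  qed
  finally show ?thesis .
qed

lemma cls_eqI:
  assumes "X \<in> baire_algebra A" "Y \<in> baire_algebra A"
    and "X - Y \<in> meagre_ideal A" "Y - X \<in> meagre_ideal A"
  shows "cls X = cls Y"
  by (rule equiv_class_eq[OF equiv_meagre_equiv]) (use assms in \<open>simp add: meagre_equiv_iff\<close>)

lemma cls_le_antisym:
  assumes "a \<in> carrier (cohen_algebra A)" "b \<in> carrier (cohen_algebra A)"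
    and "a \<sqsubseteq>\<^bsub>cohen_algebra A\<^esub> b" "b \<sqsubseteq>\<^bsub>cohen_algebra A\<^esub> a"
  shows "a = b"
proof -
  obtain X Y where XY: "X \<in> baire_algebra A" "a = cls X" "Y \<in> baire_algebra A" "b = cls Y"
    using assms(1,2) by (auto simp: carrier_cohen_algebra)
  then show ?thesis
    using assms(3,4) le_cls[OF XY(1,3)] le_cls[OF XY(3,1)] cls_eqI[OF XY(1,3)] by simp
qed

text \<open>The derived top and meet are Hilbert choices of greatest elements; antisymmetry pins
  them down. Bottom is treated likewise through least elements.\<close>

lemma SOME_greatest:
  assumes "greatest (cohen_algebra A) a S"
  shows "(SOME x. greatest (cohen_algebra A) x S) = a"
proof (rule some_equality)
  show "greatest (cohen_algebra A) a S" by fact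
  fix b assume "greatest (cohen_algebra A) b S"
  then show "b = a"
    using assms unfolding greatest_def by (intro cls_le_antisym) auto
qed

lemma SOME_least:
  assumes "least (cohen_algebra A) a S"
  shows "(SOME x. least (cohen_algebra A) x S) = a"
proof (rule some_equality)
  show "least (cohen_algebra A) a S" by fact
  fix b assume "least (cohen_algebra A) b S"
  then show "b = a"
    using assms unfolding least_def by (intro cls_le_antisym) auto
qed

lemma top_cohen_algebra: "\<top>\<^bsub>cohen_algebra A\<^esub> = cls (extensional A)"
proof -
  have "X - extensional A \<in> meagre_ideal A" if "X \<in> baire_algebra A" for X
    by (rule ideal_subset[OF ideal_empty]) (use sets_into_space[OF that] in blast)
  then have "greatest (cohen_algebra A) (cls (extensional A)) (carrier (cohen_algebra A))"
    using top by (auto simp: greatest_def carrier_cohen_algebra le_cls)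
  then show ?thesis unfolding top_def by (rule SOME_greatest)
qed

lemma bottom_cohen_algebra: "\<bottom>\<^bsub>cohen_algebra A\<^esub> = cls {}"
proof -
  have "least (cohen_algebra A) (cls {}) (carrier (cohen_algebra A))"
    using ideal_empty by (auto simp: least_def carrier_cohen_algebra le_cls)
  then show ?thesis unfolding bottom_def by (rule SOME_least)
qed

lemma meet_cls:
  assumes X: "X \<in> baire_algebra A" and Y: "Y \<in> baire_algebra A"
  shows "cls X \<sqinter>\<^bsub>cohen_algebra A\<^esub> cls Y = cls (X \<inter> Y)"
proof -
  have XY: "X \<inter> Y \<in> baire_algebra A" using X Y by (rule Int)
  have "X \<inter> Y - X \<in> meagre_ideal A" "X \<inter> Y - Y \<in> meagre_ideal A"
    by (rule ideal_subset[OF ideal_empty], blast)+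
  moreover have "Z - X \<inter> Y \<in> meagre_ideal A"
    if "Z - X \<in> meagre_ideal A" "Z - Y \<in> meagre_ideal A" for Z
    by (rule ideal_subset[OF ideal_Un[OF that]]) blast
  ultimately have "greatest (cohen_algebra A) (cls (X \<inter> Y)) (Lower (cohen_algebra A) {cls X, cls Y})"
    using X Y XY by (auto simp: greatest_def Lower_def carrier_cohen_algebra le_cls)
  then show ?thesis unfolding meet_def inf_def by (rule SOME_greatest)
qed

lemma ultrafilter_on_cohen_algebra:
  assumes V: "p_ultrafilter V"
  shows "ultrafilter_on (cohen_algebra A) (cls ` V)"
  unfolding ultrafilter_on_def
proof (intro conjI allI impI)
  note VM = p_ultrafilterD(1)[OF V] and VN = p_ultrafilterD(2)[OF V]
  have neq: "cls {} \<notin> cls ` V"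
  proof
    assume "cls {} \<in> cls ` V"
    then obtain X where X: "X \<in> V" "cls X = cls {}" by auto
    have "X \<in> cls X" using VM[OF X(1)] ideal_empty by (simp add: meagre_equiv_iff)
    then have "X - {} \<in> meagre_ideal A" using X(2) by (auto simp: meagre_equiv_iff)
    then show False using VN[OF X(1)] by simp
  qed
  show "proper_filter (cohen_algebra A) (cls ` V)"
    unfolding proper_filter_def
  proof (intro conjI ballI impI)
    show "cls ` V \<subseteq> carrier (cohen_algebra A)"
      using VM by (auto simp: carrier_cohen_algebra)
    have "extensional A \<in> V"
      using p_ultrafilterD(5)[OF V empty_sets] VN ideal_empty by auto
    then show "\<top>\<^bsub>cohen_algebra A\<^esub> \<in> cls ` V" by (simp add: top_cohen_algebra)
    show "\<bottom>\<^bsub>cohen_algebra A\<^esub> \<notin> cls ` V" using neq by (simp add: bottom_cohen_algebra)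
    fix x assume "x \<in> cls ` V"
    then obtain X where X: "X \<in> V" "x = cls X" by blast
    show "x \<sqinter>\<^bsub>cohen_algebra A\<^esub> y \<in> cls ` V" if y: "y \<in> cls ` V" for y
    proof -
      obtain Y where Y: "Y \<in> V" "y = cls Y" using y by blast
      have "x \<sqinter>\<^bsub>cohen_algebra A\<^esub> y = cls (X \<inter> Y)"
        unfolding X(2) Y(2) by (intro meet_cls VM X(1) Y(1))
      then show ?thesis using p_ultrafilterD(3)[OF V X(1) Y(1)] by simp
    qed
    show "y \<in> cls ` V" if y: "y \<in> carrier (cohen_algebra A)" "x \<sqsubseteq>\<^bsub>cohen_algebra A\<^esub> y" for y
    proof -
      obtain Y where Y: "Y \<in> baire_algebra A" "y = cls Y"
        using y(1) by (auto simp: carrier_cohen_algebra)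
      then have "X - Y \<in> meagre_ideal A" using y(2) X(2) le_cls[OF VM[OF X(1)] Y(1)] by simp
      then show ?thesis using p_ultrafilterD(4)[OF V X(1) Y(1)] Y(2) by simp
    qed
  qed
  fix F assume F: "proper_filter (cohen_algebra A) F \<and> cls ` V \<subseteq> F"
  have "a \<in> cls ` V" if a: "a \<in> F" for a
  proof (rule ccontr)
    \<comment> \<open>If \<open>a\<close> is not in the image of \<open>V\<close>, its complement
      is, and their meet puts the bottom into \<open>F\<close>.\<close>
    assume na: "a \<notin> cls ` V"
    have "a \<in> carrier (cohen_algebra A)" using F a by (auto simp: proper_filter_def)
    then obtain X where X: "X \<in> baire_algebra A" "a = cls X"
      by (auto simp: carrier_cohen_algebra)
    then have XV: "extensional A - X \<in> V" using na p_ultrafilterD(5)[OF V X(1)] by blast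
    then have "cls (extensional A - X) \<in> F" using F by blast
    then have "cls X \<sqinter>\<^bsub>cohen_algebra A\<^esub> cls (extensional A - X) \<in> F"
      using F a X(2) by (simp add: proper_filter_def)
    moreover have "cls X \<sqinter>\<^bsub>cohen_algebra A\<^esub> cls (extensional A - X) = \<bottom>\<^bsub>cohen_algebra A\<^esub>"
      using meet_cls[OF X(1) VM[OF XV]] by (simp add: bottom_cohen_algebra)
    ultimately show False using F by (simp add: proper_filter_def)
  qed
  then show "F = cls ` V" using F by blast
qed

section \<open>Failure of Tukey maximality\<close>

lemma card_of_carrier_cohen_algebra: "|UNIV :: nat set set| \<le>o |carrier (cohen_algebra A)|"
proof -
  obtain E :: "nat set \<Rightarrow> ('a \<Rightarrow> bool) set" where E: "\<And>S. E S \<in> baire_algebra A"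
      "\<And>S T. E S - E T \<in> meagre_ideal A \<Longrightarrow> S \<subseteq> T"
    using continuum_many_inequivalent[OF infinite_index] by auto
  have "inj (\<lambda>S. cls (E S))"
  proof (rule injI)
    fix S T assume eq: "cls (E S) = cls (E T)"
    have "E S \<in> cls (E S)" using E(1) ideal_empty by (simp add: meagre_equiv_iff)
    then have "E S - E T \<in> meagre_ideal A" "E T - E S \<in> meagre_ideal A"
      using eq by (auto simp: meagre_equiv_iff)
    then show "S = T" using E(2) by blast
  qed
  moreover have "range (\<lambda>S. cls (E S)) \<subseteq> carrier (cohen_algebra A)"
    using E(1) by (auto simp: carrier_cohen_algebra)
  ultimately show ?thesis using card_of_ordLeq by blast
qed

text \<open>A reduction sends the singletons to a family of at least continuum many members of the
  ultrafilter, indexed by the carrier. An element \<open>e\<close> below infinitely many of them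
  would force the finite set \<open>g (cls e)\<close> to be infinite. Cylinders serve as the dense
  family, and \<open>A\<close> as the bound on their finite sets.\<close>

lemma not_tukey_maximal_p_ultrafilter:
  assumes V: "p_ultrafilter V" and small: "|A| <o |UNIV :: nat set set|"
  shows "\<not> tukey_maximal (cohen_algebra A) (cls ` V)"
proof
  let ?I = "carrier (cohen_algebra A)"
  assume "tukey_maximal (cohen_algebra A) (cls ` V)"
  then have "\<exists>f \<in> Fpow ?I \<rightarrow> cls ` V. \<exists>g \<in> cls ` V \<rightarrow> Fpow ?I.
      \<forall>d\<in>Fpow ?I. \<forall>e\<in>cls ` V. e \<sqsubseteq>\<^bsub>cohen_algebra A\<^esub> f d \<longrightarrow> d \<subseteq> g e"
    by (simp add: tukey_maximal_def tukey_reducible_def finite_subsets_def)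
  then obtain f g where f: "f \<in> Fpow ?I \<rightarrow> cls ` V" and g: "g \<in> cls ` V \<rightarrow> Fpow ?I"
    and fg: "\<forall>d\<in>Fpow ?I. \<forall>e\<in>cls ` V. e \<sqsubseteq>\<^bsub>cohen_algebra A\<^esub> f d \<longrightarrow> d \<subseteq> g e"
    by (elim bexE) (rule that)
  have "\<forall>x\<in>?I. \<exists>X\<in>V. f {x} = cls X"
  proof
    fix x assume "x \<in> ?I"
    then have "{x} \<in> Fpow ?I" by (simp add: Fpow_def)
    with f have "f {x} \<in> cls ` V" by (rule funcset_mem)
    then show "\<exists>X\<in>V. f {x} = cls X" by blast
  qed
  then obtain a where a: "\<And>x. x \<in> ?I \<Longrightarrow> a x \<in> V" "\<And>x. x \<in> ?I \<Longrightarrow> f {x} = cls (a x)"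
    by metis
  have D: "|Fpow (cylinders A)| \<le>o |A|"
    using card_of_Fpow_ordLeq[OF card_of_cylinders_le[OF infinite_index] infinite_index] .
  have I: "|A| <o |?I|"
    using small card_of_carrier_cohen_algebra ordLess_ordLeq_trans by blast
  have sub: "cylinders A \<subseteq> baire_algebra A" using cylinder_in_baire_algebra by blast
  have "\<exists>e\<in>V. infinite {x\<in>?I. e - a x \<in> meagre_ideal A}"
  proof (rule p_ultrafilter_infinite_bounded_subfamily[OF V sub D infinite_index _ _ I])
    show "\<exists>d. range d \<subseteq> cylinders A \<and> X - (\<Union>n :: nat. d n) \<in> meagre_ideal A \<and>
        (\<Union>n. d n) - X \<in> meagre_ideal A" if "X \<in> baire_algebra A" for X
      using baire_algebra_mod_meagre_sequence[OF infinite_index that] .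
  qed (rule a(1))
  then obtain e where e: "e \<in> V" "infinite {x\<in>?I. e - a x \<in> meagre_ideal A}" by blast
  have "{x\<in>?I. e - a x \<in> meagre_ideal A} \<subseteq> g (cls e)"
  proof
    fix x assume x: "x \<in> {x\<in>?I. e - a x \<in> meagre_ideal A}"
    then have "cls e \<sqsubseteq>\<^bsub>cohen_algebra A\<^esub> f {x}"
      using a e(1) p_ultrafilterD(1)[OF V] by (simp add: le_cls)
    moreover have "{x} \<in> Fpow ?I" using x by (simp add: Fpow_def)
    ultimately have "{x} \<subseteq> g (cls e)" using fg e(1) by blast
    then show "x \<in> g (cls e)" by simp
  qed
  moreover have "finite (g (cls e))" using g e(1) by (auto simp: Fpow_def)
  ultimately show False using e(2) finite_subset by blast
qed

lemma ex_p_ultrafilter_baire_algebra: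
  assumes d: "dominating_number =o ctwo ^c natLeq" and small: "|A| <o |UNIV :: nat set set|"
  shows "\<exists>V. p_ultrafilter V"
proof (rule ex_p_ultrafilter)
  show "\<not> dominating_family F" if "|F| <o |UNIV :: nat set set|" for F
    using not_dominating_family_of_small[OF d that] .
  \<comment> \<open>Countable unions of cylinders represent all classes, and there are at most
    continuum many sequences of cylinders.\<close>
  let ?R = "(\<lambda>d. \<Union>n :: nat. d n) ` {d. range d \<subseteq> cylinders A}"
  have "|cylinders A| \<le>o |UNIV :: nat set set|"
    using card_of_cylinders_le[OF infinite_index] small ordLess_imp_ordLeq ordLeq_transitive by blast
  then show "|?R| \<le>o |UNIV :: nat set set|"
    using card_of_image card_of_nat_sequences ordLeq_transitive by blast
  show "?R \<subseteq> baire_algebra A"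
    using cylinder_in_baire_algebra by (auto intro!: countable_UN)
  show "\<exists>Y\<in>?R. X - Y \<in> meagre_ideal A \<and> Y - X \<in> meagre_ideal A" if X: "X \<in> baire_algebra A" for X
  proof -
    obtain d where "range d \<subseteq> cylinders A" "X - (\<Union>n :: nat. d n) \<in> meagre_ideal A"
        "(\<Union>n. d n) - X \<in> meagre_ideal A"
      using baire_algebra_mod_meagre_sequence[OF infinite_index X] by auto
    then show ?thesis by (intro bexI[of _ "\<Union>n. d n"]) auto
  qed
qed

end

theorem mainTheorem7:
  fixes \<kappa> :: "'a rel"
  assumes "dominating_number =o ctwo ^c natLeq"
    and "Card_order \<kappa>" and "natLeq \<le>o \<kappa>" and "\<kappa> <o ctwo ^c natLeq"
  shows "\<exists>U. ultrafilter_on (cohen_algebra (Field \<kappa>)) U \<and>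
             \<not> tukey_maximal (cohen_algebra (Field \<kappa>)) U"
proof -
  have Field: "|Field \<kappa>| =o \<kappa>" using assms(2) by (rule card_of_Field_ordIso)
  then have "natLeq \<le>o |Field \<kappa>|"
    using assms(3) ordIso_symmetric ordLeq_ordIso_trans by blast
  then interpret infinite_index "Field \<kappa>"
    using infinite_iff_natLeq_ordLeq by unfold_locales blast
  have small: "|Field \<kappa>| <o |UNIV :: nat set set|"
    using Field assms(4) continuum_ordIso ordIso_ordLess_trans ordLess_ordIso_trans by blast
  obtain V where "p_ultrafilter V"
    using ex_p_ultrafilter_baire_algebra[OF assms(1) small] by blast
  then show ?thesis
    using ultrafilter_on_cohen_algebra not_tukey_maximal_p_ultrafilter[OF _ small] by blast
qed

end
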